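(* The DAGs returned by the algorithm $\mathrm{DPLL}_d$ (exhaustive DPLL with decomposition, defined in the context) form the language of (reduced) decision-DNNF. That is: (i) every DAG returned by $\mathrm{DPLL}_d$ is a reduced decision-DNNF circuit; and (ii) every reduced decision-DNNF circuit can be generated by some execution of $\mathrm{DPLL}_d$ (on some CNF formula, with some resolution of its nondeterministic choices).
   Context: **Formulas.** A literal is a propositional variable or its negation; a clause is a disjunction of literals; a CNF formula is a conjunction of clauses, treated as a set of clauses. For $b\in\{0,1\}$, $\Delta|_{x=b}$ is obtained from the CNF formula $\Delta$ by replacing all occurrences of the variable $x$ with $b$: a literal that evaluates to $0$ is removed from every clause containing it, and if a literal evaluates to $1$, all clauses containing it are removed. **Decision-DNNF.** An NNF circuit is a DAG whose internal nodes are labeled with conjunction (and) or disjunction (or) and whose leaves are labeled with literals or the constants $0$, $1$. A d-DNNF circuit is an NNF circuit satisfying decomposability (conjuncts of any conjunction share no variables) and determinism (disjuncts of any disjunction are pairwise logically inconsistent). The language of decision-DNNF is the set of d-DNNF circuits in which all disjunction nodes have the form $(x\wedge\alpha)\vee(\neg x\wedge\beta)$, where $x$ is a variable; here $\alpha$ and $\beta$ can be either conjunction or disjunction nodes. Such a disjunction is drawn compactly as a single decision node labeled $x$ with high child $\alpha$ and low child $\beta$; in this drawing the constants are the sinks (0-sink and 1-sink), and a literal is drawn as the decision node representing it ($x$ as $(x\wedge 1)\vee(\neg x\wedge 0)$, and $\neg x$ as $(x\wedge 0)\vee(\neg x\wedge 1)$). Circuits are compared in this compact drawing, up to isomorphism.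 A circuit is reduced if it contains no redundancy in the following sense: isomorphic nodes (decision nodes with the same label, same low child and same high child; likewise isomorphic and-nodes) have been merged; any decision node with identical children has been deleted, with pointers to it redirected to its child; and and-nodes have no duplicate children. **Algorithm $\mathrm{DPLL}_d(\Delta)$**, for a CNF formula $\Delta$: 1. If there is an empty clause in $\Delta$, return the 0-sink. 2. If there are no variables in $\Delta$, return the 1-sink. 3. Partition the clauses of $\Delta$ exhaustively into components with disjoint variable sets. This process is assumed nondeterministic: not all decomposition points have to be detected (so a single component may be returned). 4. If there is more than one component, return $\text{get-and-node}(\mathit{conjuncts})$, where $\mathit{conjuncts}$ is the set of the results $\mathrm{DPLL}_d(\Delta_c)$ over all components $\Delta_c$. 5. Let $\mathit{key}=\text{compute-key}(\Delta)$. If there exists a cache entry $(\mathit{key},\mathit{result})$, return $\mathit{result}$. 6. Select a variable $x$ of $\Delta$ (nondeterministic choice); let $\mathit{result}=\text{get-node}(x,\mathrm{DPLL}_d(\Delta|_{x=0}),\mathrm{DPLL}_d(\Delta|_{x=1}))$; insert $(\mathit{key},\mathit{result})$ into the cache; return $\mathit{result}$. Here $\text{compute-key}(\Delta)$ returns a key identifying $\Delta$: the result of a call on $\Delta$ is stored under this key, and a subsequent call on some $\Delta'$ returns the stored result if $\Delta'$ is found, by comparison of keys, to be equivalent to $\Delta$. No particular caching method is fixed. The function $\text{get-node}(x,\mathit{low},\mathit{high})$ returns a decision node labeled $x$ with the given low and high children, using a table of unique nodes: if $\mathit{low}$ and $\mathit{high}$ are the same, that node is returned; if the node $(x,\mathit{low},\mathit{high})$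 already exists in the table, the existing node is returned; otherwise a new node is created, stored in the table and returned. The function $\text{get-and-node}(\mathit{conjuncts})$ returns an and-node (conjunction) whose children are the given conjuncts; the unique-nodes technique is extended to it so that isomorphic and-nodes, as well as duplicate children of an and-node, are not created.
   Formalization: Formulas with equal cache keys must also have the same variables, since mere equivalence can break decomposability in (i); and-nodes have at least two children, and get-and-node returns a sole remaining conjunct itself, since one-child and-nodes would falsify (ii). *)

theory Defs
  imports Main "HOL-Library.Multiset" "HOL-Library.Disjoint_Sets"
begin

section \<open>CNF formulas\<close>

type_synonym var = nat

datatype lit = Pos (var_of: var) | Neg (var_of: var)

type_synonym clause = "lit set"
type_synonym cnf = "clause set"

definition is_cnf :: "cnf \<Rightarrow> bool" where
  "is_cnf \<Delta> \<longleftrightarrow> finite \<Delta> \<and> (\<forall>c\<in>\<Delta>. finite c)"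

definition vars :: "cnf \<Rightarrow> var set" where
  "vars \<Delta> = var_of ` \<Union>\<Delta>"

fun lit_true :: "(var \<Rightarrow> bool) \<Rightarrow> lit \<Rightarrow> bool" where
  "lit_true \<sigma> (Pos x) = \<sigma> x"
| "lit_true \<sigma> (Neg x) = (\<not> \<sigma> x)"

definition cnf_true :: "(var \<Rightarrow> bool) \<Rightarrow> cnf \<Rightarrow> bool" where
  "cnf_true \<sigma> \<Delta> \<longleftrightarrow> (\<forall>c\<in>\<Delta>. \<exists>l\<in>c. lit_true \<sigma> l)"

definition condition :: "cnf \<Rightarrow> var \<Rightarrow> bool \<Rightarrow> cnf" where
  "condition \<Delta> x b =
     (let true_lit = (if b then Pos x else Neg x); false_lit = (if b then Neg x else Pos x)
      in (\<lambda>c. c - {false_lit}) ` {c \<in> \<Delta>. true_lit \<notin> c})"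


section \<open>Rooted directed acyclic graphs\<close>

text \<open>
  A graph is a finite partial map from nodes to labels, where a label contains the pointers to
  the children; the function \<open>ch\<close> extracts them.
\<close>

definition edges :: "('l \<Rightarrow> 'n set) \<Rightarrow> ('n \<rightharpoonup> 'l) \<Rightarrow> ('n \<times> 'n) set" where
  "edges ch G = {(n, m). \<exists>l. G n = Some l \<and> m \<in> ch l}"

definition reach :: "('l \<Rightarrow> 'n set) \<Rightarrow> ('n \<rightharpoonup> 'l) \<Rightarrow> 'n \<Rightarrow> 'n set" where
  "reach ch G n = {m. (n, m) \<in> (edges ch G)\<^sup>*}"

definition rooted_dag :: "('l \<Rightarrow> 'n set) \<Rightarrow> ('n \<rightharpoonup> 'l) \<Rightarrow> 'n \<Rightarrow> bool" where
  "rooted_dag ch G r \<longleftrightarrow>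
     finite (dom G) \<and> r \<in> dom G \<and> (\<forall>l \<in> ran G. ch l \<subseteq> dom G) \<and>
     acyclic (edges ch G) \<and> dom G \<subseteq> reach ch G r"


section \<open>NNF circuits, d-DNNF and decision-DNNF\<close>

datatype (nnf_children: 'n) nnf_node =
  Const bool | Lit lit | Conj "'n multiset" | Disj "'n multiset"

text \<open>
  Conjunctions and disjunctions have at least two children (counted with multiplicity).
  In particular there is no unary conjunction.
\<close>

definition nnf_circuit :: "('n \<rightharpoonup> 'n nnf_node) \<Rightarrow> 'n \<Rightarrow> bool" where
  "nnf_circuit N r \<longleftrightarrow>
     rooted_dag nnf_children N r \<and>
     (\<forall>n M. N n = Some (Conj M) \<or> N n = Some (Disj M) \<longrightarrow> size M \<ge> 2)"

text \<open>On an acyclic graph this least fixed point is the usual bottom-up evaluation.\<close>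

inductive nnf_true :: "('n \<rightharpoonup> 'n nnf_node) \<Rightarrow> (var \<Rightarrow> bool) \<Rightarrow> 'n \<Rightarrow> bool"
  for N :: "'n \<rightharpoonup> 'n nnf_node" and \<sigma> :: "var \<Rightarrow> bool" where
  "N n = Some (Const True) \<Longrightarrow> nnf_true N \<sigma> n"
| "N n = Some (Lit l) \<Longrightarrow> lit_true \<sigma> l \<Longrightarrow> nnf_true N \<sigma> n"
| "N n = Some (Conj M) \<Longrightarrow> (\<forall>m. m \<in># M \<longrightarrow> nnf_true N \<sigma> m) \<Longrightarrow> nnf_true N \<sigma> n"
| "N n = Some (Disj M) \<Longrightarrow> m \<in># M \<Longrightarrow> nnf_true N \<sigma> m \<Longrightarrow> nnf_true N \<sigma> n"

definition nnf_vars :: "('n \<rightharpoonup> 'n nnf_node) \<Rightarrow> 'n \<Rightarrow> var set" where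
  "nnf_vars N n = {var_of l | l m. m \<in> reach nnf_children N n \<and> N m = Some (Lit l)}"

definition decomposable :: "('n \<rightharpoonup> 'n nnf_node) \<Rightarrow> bool" where
  "decomposable N \<longleftrightarrow>
     (\<forall>n M. N n = Some (Conj M) \<longrightarrow>
        (\<forall>m m'. {#m, m'#} \<subseteq># M \<longrightarrow> nnf_vars N m \<inter> nnf_vars N m' = {}))"

definition deterministic :: "('n \<rightharpoonup> 'n nnf_node) \<Rightarrow> bool" where
  "deterministic N \<longleftrightarrow>
     (\<forall>n M. N n = Some (Disj M) \<longrightarrow>
        (\<forall>m m'. {#m, m'#} \<subseteq># M \<longrightarrow> (\<forall>\<sigma>. \<not> (nnf_true N \<sigma> m \<and> nnf_true N \<sigma> m'))))"

definition d_DNNF :: "('n \<rightharpoonup> 'n nnf_node) \<Rightarrow> 'n \<Rightarrow> bool" where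
  "d_DNNF N r \<longleftrightarrow> nnf_circuit N r \<and> decomposable N \<and> deterministic N"

definition decision_form :: "('n \<rightharpoonup> 'n nnf_node) \<Rightarrow> 'n multiset \<Rightarrow> bool" where
  "decision_form N M \<longleftrightarrow>
     (\<exists>x a b p q \<alpha> \<beta>. M = {#a, b#} \<and>
        N a = Some (Conj {#p, \<alpha>#}) \<and> N p = Some (Lit (Pos x)) \<and>
        N b = Some (Conj {#q, \<beta>#}) \<and> N q = Some (Lit (Neg x)))"

definition decision_DNNF :: "('n \<rightharpoonup> 'n nnf_node) \<Rightarrow> 'n \<Rightarrow> bool" where
  "decision_DNNF N r \<longleftrightarrow>
     d_DNNF N r \<and> (\<forall>n M. N n = Some (Disj M) \<longrightarrow> decision_form N M)"


section \<open>The compact drawing\<close>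

text \<open>\<open>Dec x low high\<close> is the decision node labeled \<open>x\<close>.\<close>

datatype (children: 'n) node =
  Sink bool | Dec var 'n 'n | And "'n multiset"

type_synonym 'n dag = "'n \<rightharpoonup> 'n node"

text \<open>
  The NNF circuit that a compact drawing stands for: a decision node \<open>n = Dec x low high\<close> is
  \<open>(x \<and> high) \<or> (\<not>x \<and> low)\<close>, with the two conjunctions placed at the auxiliary nodes \<open>Hi n\<close>
  and \<open>Lo n\<close>.
\<close>

datatype 'n xnode = Node 'n | Hi 'n | Lo 'n | Leaf lit

fun expand :: "'n dag \<Rightarrow> 'n xnode \<Rightarrow> 'n xnode nnf_node option" where
  "expand G (Node n) =
     (case G n of
        None \<Rightarrow> None
      | Some (Sink b) \<Rightarrow> Some (Const b)
      | Some (Dec x low high) \<Rightarrow> Some (Disj {#Hi n, Lo n#})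
      | Some (And M) \<Rightarrow> Some (Conj (image_mset Node M)))"
| "expand G (Hi n) =
     (case G n of
        Some (Dec x low high) \<Rightarrow> Some (Conj {#Leaf (Pos x), Node high#})
      | _ \<Rightarrow> None)"
| "expand G (Lo n) =
     (case G n of
        Some (Dec x low high) \<Rightarrow> Some (Conj {#Leaf (Neg x), Node low#})
      | _ \<Rightarrow> None)"
| "expand G (Leaf l) =
     (if \<exists>n low high. G n = Some (Dec (var_of l) low high) then Some (Lit l) else None)"

definition decision_DNNF_drawing :: "'n dag \<Rightarrow> 'n \<Rightarrow> bool" where
  "decision_DNNF_drawing G r \<longleftrightarrow>
     rooted_dag children G r \<and> decision_DNNF (expand G) (Node r)"

text \<open>
  Isomorphic nodes are nodes with equal labels, since a label includes the child pointers.
\<close>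

definition reduced :: "'n dag \<Rightarrow> bool" where
  "reduced G \<longleftrightarrow>
     inj_on G (dom G) \<and>
     (\<forall>n x low high. G n = Some (Dec x low high) \<longrightarrow> low \<noteq> high) \<and>
     (\<forall>n M. G n = Some (And M) \<longrightarrow> (\<forall>m. count M m \<le> 1))"

definition dag_iso :: "'m dag \<Rightarrow> 'm \<Rightarrow> 'n dag \<Rightarrow> 'n \<Rightarrow> bool" where
  "dag_iso G r H s \<longleftrightarrow>
     (\<exists>f. bij_betw f (dom G) (dom H) \<and> f r = s \<and>
          (\<forall>n \<in> dom G. H (f n) = map_option (map_node f) (G n)))"


section \<open>Exhaustive DPLL with decomposition\<close>

text \<open>
  A state consists of the table of unique nodes and the cache. Node identifiers are natural
  numbers; those of the two sinks are fixed.
\<close>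

type_synonym 'k state = "nat dag \<times> ('k \<rightharpoonup> nat)"

definition zero_sink :: nat where "zero_sink = 0"
definition one_sink :: nat where "one_sink = 1"

definition init_state :: "'k state" where
  "init_state = ([zero_sink \<mapsto> Sink False, one_sink \<mapsto> Sink True], Map.empty)"

definition lookup_or_create :: "nat node \<Rightarrow> nat dag \<Rightarrow> nat \<Rightarrow> nat dag \<Rightarrow> bool" where
  "lookup_or_create l T r T' \<longleftrightarrow>
     (if l \<in> ran T then T r = Some l \<and> T' = T
      else r \<notin> dom T \<and> T' = T(r \<mapsto> l))"

definition get_node :: "var \<Rightarrow> nat \<Rightarrow> nat \<Rightarrow> nat dag \<Rightarrow> nat \<Rightarrow> nat dag \<Rightarrow> bool" where
  "get_node x low high T r T' \<longleftrightarrow>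
     (if low = high then r = low \<and> T' = T
      else lookup_or_create (Dec x low high) T r T')"

text \<open>
  If all conjuncts are the same node, removing duplicates leaves a single one, and the
  conjunction is that node itself (as for a decision node with identical children).
\<close>

definition get_and_node :: "nat set \<Rightarrow> nat dag \<Rightarrow> nat \<Rightarrow> nat dag \<Rightarrow> bool" where
  "get_and_node R T r T' \<longleftrightarrow>
     (R = {r} \<and> T' = T) \<or>
     (\<not> is_singleton R \<and> lookup_or_create (And (mset_set R)) T r T')"

text \<open>
  The components are listed in the order in which they are processed. They need not be
  connected, since decomposition points may be missed.
\<close>

definition components :: "cnf \<Rightarrow> cnf list \<Rightarrow> bool" where
  "components \<Delta> \<Delta>s \<longleftrightarrow>
     distinct \<Delta>s \<and> partition_on \<Delta> (set \<Delta>s) \<and> disjoint_family_on vars (set \<Delta>s)"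

text \<open>
  Keys never confuse inequivalent formulas, where formulas are compared as Boolean functions
  of the variables they mention. The variable sets matter: if a formula could hit an entry of
  a formula over other variables (e.g. any two unsatisfiable ones), the stored circuit could
  share variables with a sibling conjunct, and decomposability would fail.
\<close>

definition sound_key :: "(cnf \<Rightarrow> 'k) \<Rightarrow> bool" where
  "sound_key key \<longleftrightarrow>
     (\<forall>\<Delta> \<Delta>'. is_cnf \<Delta> \<longrightarrow> is_cnf \<Delta>' \<longrightarrow> key \<Delta> = key \<Delta>' \<longrightarrow>
        vars \<Delta> = vars \<Delta>' \<and> (\<forall>\<sigma>. cnf_true \<sigma> \<Delta> = cnf_true \<sigma> \<Delta>'))"

lemma sound_key_identity: "sound_key (\<lambda>\<Delta>. \<Delta>)"
  by (simp add: sound_key_def)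

text \<open>
  \<open>dpll key s \<Delta> r s'\<close>: the call on \<open>\<Delta>\<close> in state \<open>s\<close> can return node \<open>r\<close> in state \<open>s'\<close>.
  The last two rules are the case that the decomposition step returns a single component.
\<close>

inductive dpll :: "(cnf \<Rightarrow> 'k) \<Rightarrow> 'k state \<Rightarrow> cnf \<Rightarrow> nat \<Rightarrow> 'k state \<Rightarrow> bool"
  and dpll_list :: "(cnf \<Rightarrow> 'k) \<Rightarrow> 'k state \<Rightarrow> cnf list \<Rightarrow> nat list \<Rightarrow> 'k state \<Rightarrow> bool"
  for key :: "cnf \<Rightarrow> 'k" where
  empty_clause:
    "{} \<in> \<Delta> \<Longrightarrow> dpll key s \<Delta> zero_sink s"
| no_variables:
    "{} \<notin> \<Delta> \<Longrightarrow> vars \<Delta> = {} \<Longrightarrow> dpll key s \<Delta> one_sink s"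
| decompose:
    "{} \<notin> \<Delta> \<Longrightarrow> vars \<Delta> \<noteq> {} \<Longrightarrow>
     components \<Delta> \<Delta>s \<Longrightarrow> length \<Delta>s > 1 \<Longrightarrow>
     dpll_list key s \<Delta>s rs (T, K) \<Longrightarrow>
     get_and_node (set rs) T r T' \<Longrightarrow>
     dpll key s \<Delta> r (T', K)"
| cache_hit:
    "{} \<notin> \<Delta> \<Longrightarrow> vars \<Delta> \<noteq> {} \<Longrightarrow>
     K (key \<Delta>) = Some r \<Longrightarrow>
     dpll key (T, K) \<Delta> r (T, K)"
| branch:
    "{} \<notin> \<Delta> \<Longrightarrow> x \<in> vars \<Delta> \<Longrightarrow>
     K (key \<Delta>) = None \<Longrightarrow>
     dpll key (T, K) (condition \<Delta> x False) low s1 \<Longrightarrow>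
     dpll key s1 (condition \<Delta> x True) high (T2, K2) \<Longrightarrow>
     get_node x low high T2 r T3 \<Longrightarrow>
     dpll key (T, K) \<Delta> r (T3, K2(key \<Delta> \<mapsto> r))"
| list_nil:
    "dpll_list key s [] [] s"
| list_cons:
    "dpll key s \<Delta> r s1 \<Longrightarrow> dpll_list key s1 \<Delta>s rs s2 \<Longrightarrow>
     dpll_list key s (\<Delta> # \<Delta>s) (r # rs) s2"

text \<open>The returned DAG is the part of the node table that is reachable from the returned node.\<close>

definition dpll_returns :: "(cnf \<Rightarrow> 'k) \<Rightarrow> cnf \<Rightarrow> nat dag \<Rightarrow> nat \<Rightarrow> bool" where
  "dpll_returns key \<Delta> G r \<longleftrightarrow>
     (\<exists>T K. dpll key init_state \<Delta> r (T, K) \<and> G = T |` reach children T r)"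

end

theory Submission
  imports Defs
begin

text \<open>
  Soundness: by induction over the run, the decision variables below a returned node occur in
  the formula it was returned for. Conditioning removes the branching variable and components
  share no variables, so decision nodes test no variable twice and conjunctions decompose; a cache
  hit preserves this because keys determine the variable set.

  Completeness: a CNF is read off the circuit by unfolding it into a tree. A decision node
  becomes \<open>x \<or> \<Delta>0\<close>, \<open>\<not>x \<or> \<Delta>1\<close> and an and-node the union of the formulas of its children. The
  difficulty is that an arbitrary sound key may identify equivalent formulas, whereas a reduced
  circuit may contain several nodes for one Boolean function. Therefore every occurrence of
  a sink or decision node in the unfolding owns a fresh variable that is mentioned in its formula
  but semantically irrelevant. Then no call hits the cache, and the sharing in the circuit is
  recovered from the table of unique nodes alone.
\<close>

section \<open>Circuits in compact drawing\<close>

text \<open>The counterpart of \<open>nnf_vars\<close> on the drawing. Literals have no nodes of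
  their own there, so variables are read off the labels of decision nodes;
  \<open>nnf_vars_expand_Node\<close> shows that both notions agree.\<close>

definition dvars :: "'n dag \<Rightarrow> 'n \<Rightarrow> var set" where
  "dvars G n = {x. \<exists>m \<in> reach children G n. \<exists>low high. G m = Some (Dec x low high)}"

fun label_vars :: "'n node \<Rightarrow> var set" where
  "label_vars (Dec x low high) = {x}"
| "label_vars _ = {}"

section \<open>Reachability and the decision variables below a node\<close>

lemma mem_edges: "(n, m) \<in> edges ch G \<longleftrightarrow> (\<exists>l. G n = Some l \<and> m \<in> ch l)"
  by (simp add: edges_def)

lemma reach_refl [simp]: "n \<in> reach ch G n"
  by (simp add: reach_def)

lemma reach_step: "G n = Some l \<Longrightarrow> m \<in> ch l \<Longrightarrow> k \<in> reach ch G m \<Longrightarrow> k \<in> reach ch G n"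
  unfolding reach_def by (simp add: converse_rtrancl_into_rtrancl mem_edges)

lemma reach_snoc: "m \<in> reach ch G n \<Longrightarrow> G m = Some l \<Longrightarrow> k \<in> ch l \<Longrightarrow> k \<in> reach ch G n"
  unfolding reach_def by (simp add: rtrancl.rtrancl_into_rtrancl mem_edges)

text \<open>Path induction as a closure principle: below, a reachable set is bounded by exhibiting a
  set that is closed under children.\<close>

lemma reach_subset:
  assumes "n \<in> A" "\<And>m l. m \<in> A \<Longrightarrow> G m = Some l \<Longrightarrow> ch l \<subseteq> A"
  shows "reach ch G n \<subseteq> A"
proof -
  have "m \<in> A" if "(n, m) \<in> (edges ch G)\<^sup>*" for m
    using that by induction (use assms in \<open>auto simp: mem_edges\<close>)
  then show ?thesis by (auto simp: reach_def)
qed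

lemma reach_unfold:
  assumes "G n = Some l"
  shows "reach ch G n = insert n (\<Union>m \<in> ch l. reach ch G m)"
proof
  show "reach ch G n \<subseteq> insert n (\<Union>m \<in> ch l. reach ch G m)"
    by (rule reach_subset) (use assms in \<open>auto intro: reach_snoc\<close>)
  show "insert n (\<Union>m \<in> ch l. reach ch G m) \<subseteq> reach ch G n"
    using assms by (auto intro: reach_step)
qed

lemma dvars_unfold:
  assumes "G n = Some l"
  shows "dvars G n = label_vars l \<union> (\<Union>m \<in> children l. dvars G m)"
proof -
  have "(\<exists>low high. G n = Some (Dec x low high)) \<longleftrightarrow> x \<in> label_vars l" for x
    using assms by (cases l) auto
  moreover have "reach children G n = insert n (\<Union>m \<in> children l. reach children G m)"
    by (rule reach_unfold) (rule assms)
  ultimately show ?thesis by (auto simp: dvars_def)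
qed

section \<open>The expansion of a drawing and its variables\<close>

lemma expand_SomeE:
  assumes "expand G v = Some l"
  obtains (sink) n b where "v = Node n" "G n = Some (Sink b)" "l = Const b"
  | (dec) n x low high where "v = Node n" "G n = Some (Dec x low high)" "l = Disj {#Hi n, Lo n#}"
  | (conj) n M where "v = Node n" "G n = Some (And M)" "l = Conj (image_mset Node M)"
  | (hi) n x low high where "v = Hi n" "G n = Some (Dec x low high)"
      "l = Conj {#Leaf (Pos x), Node high#}"
  | (lo) n x low high where "v = Lo n" "G n = Some (Dec x low high)"
      "l = Conj {#Leaf (Neg x), Node low#}"
  | (leaf) n k low high where "v = Leaf k" "G n = Some (Dec (var_of k) low high)" "l = Lit k"
proof (cases v)
  case (Node n)
  with assms show ?thesis
    by (cases "G n"; cases "the (G n)") (auto intro: sink dec conj)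
next
  case (Hi n)
  with assms show ?thesis
    by (cases "G n"; cases "the (G n)") (auto intro: hi)
next
  case (Lo n)
  with assms show ?thesis
    by (cases "G n"; cases "the (G n)") (auto intro: lo)
next
  case (Leaf k)
  with assms show ?thesis
    by (auto intro: leaf split: if_splits)
qed

lemma expand_Leaf: "G n = Some (Dec (var_of k) low high) \<Longrightarrow> expand G (Leaf k) = Some (Lit k)"
  by (subst expand.simps, rule if_P) blast

lemma expand_Node_dom: "n \<in> dom G \<Longrightarrow> Node n \<in> dom (expand G)"
  by (cases "the (G n)") auto

lemma expand_Dec:
  assumes "G n = Some (Dec x low high)"
  shows "expand G (Node n) = Some (Disj {#Hi n, Lo n#})"
    "expand G (Hi n) = Some (Conj {#Leaf (Pos x), Node high#})"
    "expand G (Lo n) = Some (Conj {#Leaf (Neg x), Node low#})"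
  using assms by simp_all

lemma expand_And: "G n = Some (And M) \<Longrightarrow> expand G (Node n) = Some (Conj (image_mset Node M))"
  by simp

declare expand.simps [simp del] expand_Dec [simp] expand_And [simp]

lemma reach_expand_Dec:
  assumes "Node m \<in> reach nnf_children (expand G) v" "G m = Some (Dec x low high)"
  shows "{Hi m, Lo m, Node low, Node high, Leaf (Pos x), Leaf (Neg x)}
    \<subseteq> reach nnf_children (expand G) v"
proof -
  have "expand G (Node m) = Some (Disj {#Hi m, Lo m#})" using assms(2) by simp
  from reach_snoc[OF assms(1) this] have HiLo: "Hi m \<in> reach nnf_children (expand G) v"
    "Lo m \<in> reach nnf_children (expand G) v" by auto
  have "expand G (Hi m) = Some (Conj {#Leaf (Pos x), Node high#})"
    "expand G (Lo m) = Some (Conj {#Leaf (Neg x), Node low#})" using assms(2) by auto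
  with reach_snoc[OF HiLo(1) this(1)] reach_snoc[OF HiLo(2) this(2)] HiLo
  show ?thesis by auto
qed

text \<open>Each edge of the drawing lifts to a path: one edge out of an and-node, two edges through
  \<open>Hi\<close> or \<open>Lo\<close> out of a decision node.\<close>

lemma reach_expand_Node:
  assumes "Node n \<in> reach nnf_children (expand G) v" "m \<in> reach children G n"
  shows "Node m \<in> reach nnf_children (expand G) v"
proof -
  have "reach children G n \<subseteq> {m. Node m \<in> reach nnf_children (expand G) v}"
  proof (rule reach_subset)
    fix m l assume m: "m \<in> {m. Node m \<in> reach nnf_children (expand G) v}" "G m = Some l"
    show "children l \<subseteq> {m. Node m \<in> reach nnf_children (expand G) v}"
    proof (cases l)
      case (Dec x low high)
      then show ?thesis using reach_expand_Dec[of m G v] m by auto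
    next
      case (And M)
      then have "expand G (Node m) = Some (Conj (image_mset Node M))" using m by simp
      moreover have "Node m \<in> reach nnf_children (expand G) v" using m by simp
      ultimately show ?thesis using And by (auto intro: reach_snoc)
    qed simp
  qed (use assms in simp)
  then show ?thesis using assms by blast
qed

lemma nnf_vars_expand_Node: "nnf_vars (expand G) (Node n) = dvars G n"
proof
  define A where "A = {v. case v of Leaf l \<Rightarrow> var_of l \<in> dvars G n
    | Node m \<Rightarrow> m \<in> reach children G n | Hi m \<Rightarrow> m \<in> reach children G n
    | Lo m \<Rightarrow> m \<in> reach children G n}"
  have "reach nnf_children (expand G) (Node n) \<subseteq> A"
  proof (rule reach_subset)
    show "Node n \<in> A" by (simp add: A_def)
    fix v l assume v: "v \<in> A" and l: "expand G v = Some l"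
    have Dec: "x \<in> dvars G n \<and> low \<in> reach children G n \<and> high \<in> reach children G n"
      if "m \<in> reach children G n" "G m = Some (Dec x low high)" for m x low high
      using reach_snoc[OF that] that by (auto simp: dvars_def)
    have And: "k \<in> reach children G n"
      if "m \<in> reach children G n" "G m = Some (And M)" "k \<in># M" for m M k
      using reach_snoc[OF that(1,2)] that(3) by simp
    from l show "nnf_children l \<subseteq> A"
    proof (cases rule: expand_SomeE)
      case (conj m M)
      then show ?thesis using v And[of m M] by (auto simp: A_def)
    next
      case (hi m x low high)
      then show ?thesis using v Dec[of m x low high] by (simp add: A_def)
    next
      case (lo m x low high)
      then show ?thesis using v Dec[of m x low high] by (simp add: A_def)
    qed (use v in \<open>simp_all add: A_def\<close>)
  qed
  then show "nnf_vars (expand G) (Node n) \<subseteq> dvars G n"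
    by (auto simp: nnf_vars_def A_def elim!: expand_SomeE)
  show "dvars G n \<subseteq> nnf_vars (expand G) (Node n)"
  proof
    fix x assume "x \<in> dvars G n"
    then obtain m low high where m: "m \<in> reach children G n" "G m = Some (Dec x low high)"
      by (auto simp: dvars_def)
    have "Node m \<in> reach nnf_children (expand G) (Node n)"
      by (rule reach_expand_Node[OF _ m(1)]) (rule reach_refl)
    from reach_expand_Dec[OF this m(2)]
    have "Leaf (Pos x) \<in> reach nnf_children (expand G) (Node n)" by blast
    moreover have "expand G (Leaf (Pos x)) = Some (Lit (Pos x))"
      by (rule expand_Leaf[of G m]) (simp add: m)
    ultimately have "var_of (Pos x) \<in> nnf_vars (expand G) (Node n)"
      unfolding nnf_vars_def by blast
    then show "x \<in> nnf_vars (expand G) (Node n)" by simp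
  qed
qed

lemma nnf_vars_expand_Leaf:
  assumes "G n = Some (Dec (var_of l) low high)"
  shows "nnf_vars (expand G) (Leaf l) = {var_of l}"
proof -
  have l: "expand G (Leaf l) = Some (Lit l)"
    using assms by (rule expand_Leaf)
  then show ?thesis
    unfolding nnf_vars_def reach_unfold[of "expand G", OF l] by auto
qed

text \<open>What decision-DNNF means on the drawing itself. The first condition is decomposability
  of the conjunctions \<open>Hi n\<close> and \<open>Lo n\<close>; shape and determinism of
  disjunctions are built into \<open>expand\<close>. For rooted DAGs it is equivalent to
  \<open>decision_DNNF_drawing\<close>, as shown in two halves below.\<close>

definition decision_conditions :: "'n dag \<Rightarrow> bool" where
  "decision_conditions G \<longleftrightarrow>
     (\<forall>n x low high. G n = Some (Dec x low high) \<longrightarrow> x \<notin> dvars G low \<and> x \<notin> dvars G high) \<and>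
     (\<forall>n M. G n = Some (And M) \<longrightarrow> size M \<ge> 2 \<and>
        (\<forall>m m'. {#m, m'#} \<subseteq># M \<longrightarrow> dvars G m \<inter> dvars G m' = {}))"

lemma pair_subset_pair:
  "{#a, b#} \<subseteq># {#c, d#} \<longleftrightarrow> (a = c \<and> b = d) \<or> (a = d \<and> b = c)"
proof
  assume "{#a, b#} \<subseteq># {#c, d#}"
  then have "{#a, b#} = {#c, d#}"
    by (intro subset_mset.antisym) (auto simp: size_mset_mono dest: mset_subset_size
        simp: subset_mset.le_less)
  then show "(a = c \<and> b = d) \<or> (a = d \<and> b = c)"
    by (auto simp: add_eq_conv_ex)
qed (auto simp: add_mset_commute)

lemma drawing_imp_conditions:
  assumes "decision_DNNF_drawing G r"
  shows "decision_conditions G"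
  unfolding decision_conditions_def
proof (intro conjI allI impI)
  have circ: "nnf_circuit (expand G) (Node r)" and dec: "decomposable (expand G)"
    using assms by (auto simp: decision_DNNF_drawing_def decision_DNNF_def d_DNNF_def)
  { fix n x low high assume n: "G n = Some (Dec x low high)"
    then have "expand G (Hi n) = Some (Conj {#Leaf (Pos x), Node high#})"
      "expand G (Lo n) = Some (Conj {#Leaf (Neg x), Node low#})" by auto
    then have "nnf_vars (expand G) (Leaf (Pos x)) \<inter> nnf_vars (expand G) (Node high) = {}"
      "nnf_vars (expand G) (Leaf (Neg x)) \<inter> nnf_vars (expand G) (Node low) = {}"
      using dec subset_mset.order_refl unfolding decomposable_def by blast+
    with n show "x \<notin> dvars G low" "x \<notin> dvars G high"
      using nnf_vars_expand_Leaf[of G n "Pos x"] nnf_vars_expand_Leaf[of G n "Neg x"]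
      by (auto simp: nnf_vars_expand_Node) }
  fix n M assume n: "G n = Some (And M)"
  then have e: "expand G (Node n) = Some (Conj (image_mset Node M))" by simp
  then have "size (image_mset Node M) \<ge> 2"
    using circ unfolding nnf_circuit_def by blast
  then show "2 \<le> size M" by simp
  fix m m' assume "{#m, m'#} \<subseteq># M"
  then have "{#Node m, Node m'#} \<subseteq># image_mset Node M"
    using image_mset_subseteq_mono[of "{#m, m'#}" M Node] by simp
  then show "dvars G m \<inter> dvars G m' = {}"
    using dec e unfolding decomposable_def by (metis nnf_vars_expand_Node)
qed

section \<open>The expansion of a rooted DAG is a rooted DAG\<close>

lemma reach_subset_dom:
  assumes "n \<in> dom G" "\<forall>l \<in> ran G. ch l \<subseteq> dom G"
  shows "reach ch G n \<subseteq> dom G"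
  by (rule reach_subset) (use assms in \<open>auto simp: ran_def\<close>)

lemma reach_edge_psubset:
  assumes "acyclic (edges ch G)" "G n = Some l" "m \<in> ch l"
  shows "reach ch G m \<subset> reach ch G n"
  unfolding less_le_not_le
proof
  show "reach ch G m \<subseteq> reach ch G n"
    using assms by (auto intro: reach_step)
  have "(m, n) \<notin> (edges ch G)\<^sup>*"
    using assms unfolding acyclic_def by (meson mem_edges rtrancl_into_trancl2)
  then show "\<not> reach ch G n \<subseteq> reach ch G m"
    using reach_refl[of n ch G] by (auto simp: reach_def)
qed

text \<open>The number of reachable nodes serves as a rank: in an acyclic graph a child cannot reach
  its parent. It yields acyclicity of the expansion and, later, the induction over the
  circuit.\<close>

lemma card_reach_less:
  assumes fin: "finite (dom G)" and closed: "\<forall>l \<in> ran G. ch l \<subseteq> dom G"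
    and acyc: "acyclic (edges ch G)" and edge: "G n = Some l" "m \<in> ch l"
  shows "card (reach ch G m) < card (reach ch G n)"
proof (rule psubset_card_mono)
  show "finite (reach ch G n)"
    using reach_subset_dom[OF _ closed, of n] fin edge by (auto intro: finite_subset)
  show "reach ch G m \<subset> reach ch G n" by (rule reach_edge_psubset[OF acyc edge])
qed

lemma acyclic_edges_expand:
  assumes fin: "finite (dom G)" and closed: "\<forall>l \<in> ran G. children l \<subseteq> dom G"
    and acyc: "acyclic (edges children G)"
  shows "acyclic (edges nnf_children (expand G))"
proof -
  define rk where "rk n = card (reach children G n)" for n
  \<comment> \<open>Doubling the rank makes room for the auxiliary nodes: \<open>Hi n\<close> and
    \<open>Lo n\<close> lie strictly between \<open>Node n\<close> and the children of
    \<open>n\<close>, whose values are at most \<open>2 * rk n - 1\<close>.\<close>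
  define f where "f v = (case v of Node n \<Rightarrow> 2 * rk n + 1 | Hi n \<Rightarrow> 2 * rk n | Lo n \<Rightarrow> 2 * rk n
    | Leaf l \<Rightarrow> 0)" for v
  have less: "rk m < rk n" if "G n = Some l" "m \<in> children l" for n m l
    unfolding rk_def using that by (rule card_reach_less[OF fin closed acyc])
  have "f w < f v" if e: "(v, w) \<in> edges nnf_children (expand G)" for v w
  proof -
    obtain l where l: "expand G v = Some l" "w \<in> nnf_children l"
      using e by (auto simp: mem_edges)
    from l(1) show ?thesis
    proof (cases rule: expand_SomeE)
      case (hi n x low high)
      then have "rk high < rk n" using less[of n] by simp
      with hi l(2) show ?thesis by (auto simp: f_def)
    next
      case (lo n x low high)
      then have "rk low < rk n" using less[of n] by simp
      with lo l(2) show ?thesis by (auto simp: f_def)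
    qed (use l(2) less in \<open>auto simp: f_def\<close>)
  qed
  then have "(edges nnf_children (expand G))\<inverse> \<subseteq> measure f"
    by auto
  then have "acyclic ((edges nnf_children (expand G))\<inverse>)"
    using acyclic_subset wf_acyclic wf_measure by blast
  then show ?thesis by simp
qed

lemma dom_expand_subset:
  "dom (expand G) \<subseteq> Node ` dom G \<union> Hi ` dom G \<union> Lo ` dom G \<union>
     {Leaf l | l. \<exists>n low high. G n = Some (Dec (var_of l) low high)}"
  by (auto elim!: expand_SomeE)

lemma finite_label_vars:
  fixes G :: "'n dag"
  assumes "finite (dom G)"
  shows "finite (\<Union>l \<in> ran G. label_vars l)"
proof -
  have "finite (label_vars l)" for l :: "'n node" by (cases l) auto
  then show ?thesis using finite_ran[OF assms] by (intro finite_UN_I)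
qed

text \<open>Leaves are indexed by literals and not by nodes of the drawing, so their finiteness
  comes from that of the set of decision variables.\<close>

lemma finite_dom_expand:
  assumes "finite (dom G)"
  shows "finite (dom (expand G))"
proof -
  define X where "X = {x. \<exists>n low high. G n = Some (Dec x low high)}"
  have "X \<subseteq> (\<Union>l \<in> ran G. label_vars l)"
    by (force simp: X_def ran_def)
  then have "finite X" using finite_label_vars[OF assms] by (rule finite_subset)
  have "{Leaf l | l. \<exists>n low high. G n = Some (Dec (var_of l) low high)}
      \<subseteq> (\<lambda>x. Leaf (Pos x)) ` X \<union> (\<lambda>x. Leaf (Neg x)) ` X" (is "?L \<subseteq> _")
  proof
    fix v assume "v \<in> ?L"
    then obtain l where "v = Leaf l" "var_of l \<in> X" by (auto simp: X_def)
    then show "v \<in> (\<lambda>x. Leaf (Pos x)) ` X \<union> (\<lambda>x. Leaf (Neg x)) ` X" by (cases l) auto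
  qed
  then have "finite ?L" by (rule finite_subset) (simp add: \<open>finite X\<close>)
  show ?thesis
    by (rule finite_subset[OF dom_expand_subset]) (use \<open>finite ?L\<close> assms in simp)
qed

lemma rooted_dag_expand:
  assumes "rooted_dag children G r"
  shows "rooted_dag nnf_children (expand G) (Node r)"
proof -
  have fin: "finite (dom G)" and r: "r \<in> dom G" and closed: "\<forall>l \<in> ran G. children l \<subseteq> dom G"
    and acyc: "acyclic (edges children G)" and reachable: "dom G \<subseteq> reach children G r"
    using assms by (auto simp: rooted_dag_def)
  have closed': "m \<in> dom G" if "G n = Some l" "m \<in> children l" for n m l
    using closed that by (auto simp: ran_def)
  have child_dom: "nnf_children l \<subseteq> dom (expand G)" if e: "expand G v = Some l" for v l
    using e
  proof (cases rule: expand_SomeE)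
    case (dec n x low high)
    then show ?thesis by auto
  next
    case (conj n M)
    then have "Node m \<in> dom (expand G)" if "m \<in># M" for m
      using closed'[of n "And M" m] that by (intro expand_Node_dom) auto
    then show ?thesis using conj by auto
  next
    case (hi n x low high)
    then have "Node high \<in> dom (expand G)" using closed'[of n] by (intro expand_Node_dom) simp
    moreover have "expand G (Leaf (Pos x)) \<noteq> None" using expand_Leaf[of G n "Pos x"] hi by simp
    ultimately show ?thesis using hi by auto
  next
    case (lo n x low high)
    then have "Node low \<in> dom (expand G)" using closed'[of n] by (intro expand_Node_dom) simp
    moreover have "expand G (Leaf (Neg x)) \<noteq> None" using expand_Leaf[of G n "Neg x"] lo by simp
    ultimately show ?thesis using lo by auto
  qed auto
  let ?R = "reach nnf_children (expand G) (Node r)"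
  have Node: "Node n \<in> ?R" if "n \<in> dom G" for n
    using reach_expand_Node[of r G "Node r" n] reachable that by auto
  have Dec: "{Hi n, Lo n, Leaf (Pos x), Leaf (Neg x)} \<subseteq> ?R"
    if "G n = Some (Dec x low high)" for n x low high
    using reach_expand_Dec[of n G "Node r", OF _ that] Node[of n] that by auto
  have "v \<in> ?R" if e: "expand G v = Some l" for v l
    using e
  proof (cases rule: expand_SomeE)
    case (leaf n k low high)
    then show ?thesis using Dec[of n] by (cases k) auto
  qed (use Node Dec in auto)
  moreover have "Node r \<in> dom (expand G)"
    using r by (rule expand_Node_dom)
  moreover have "\<forall>l \<in> ran (expand G). nnf_children l \<subseteq> dom (expand G)"
    using child_dom unfolding ran_def by blast
  ultimately show ?thesis
    unfolding rooted_dag_def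
    using finite_dom_expand[OF fin] acyclic_edges_expand[OF fin closed acyc]
    by blast
qed

text \<open>The two conjunctions contain opposite literals of one variable; determinism of every
  expansion rests on this.\<close>

lemma not_nnf_true_Hi_Lo: "\<not> (nnf_true (expand G) \<sigma> (Hi n) \<and> nnf_true (expand G) \<sigma> (Lo n))"
proof
  assume a: "nnf_true (expand G) \<sigma> (Hi n) \<and> nnf_true (expand G) \<sigma> (Lo n)"
  then have "nnf_true (expand G) \<sigma> (Hi n)" by simp
  then obtain x low high where n: "G n = Some (Dec x low high)"
    and x: "nnf_true (expand G) \<sigma> (Leaf (Pos x))"
    by cases (auto elim!: expand_SomeE)
  have "nnf_true (expand G) \<sigma> (Lo n)" using a by simp
  then have x': "nnf_true (expand G) \<sigma> (Leaf (Neg x))"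
    by cases (use n in \<open>auto elim!: expand_SomeE\<close>)
  from x have "\<sigma> x" by cases (auto elim: expand_SomeE)
  moreover from x' have "\<not> \<sigma> x" by cases (auto elim: expand_SomeE)
  ultimately show False by simp
qed

lemma drawing_if_conditions:
  assumes rooted: "rooted_dag children G r" and conds: "decision_conditions G"
  shows "decision_DNNF_drawing G r"
proof -
  let ?N = "expand G"
  have Conj_cases: "(\<exists>n M'. G n = Some (And M') \<and> M = image_mset Node M') \<or>
      (\<exists>n x low high. G n = Some (Dec x low high) \<and>
         (M = {#Leaf (Pos x), Node high#} \<or> M = {#Leaf (Neg x), Node low#}))"
    if "?N v = Some (Conj M)" for v M
    using that by (cases rule: expand_SomeE) (auto, blast+)
  have Disj_cases: "\<exists>n x low high. G n = Some (Dec x low high) \<and> v = Node n \<and> M = {#Hi n, Lo n#}"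
    if "?N v = Some (Disj M)" for v M
    using that by (cases rule: expand_SomeE) auto
  have "nnf_circuit ?N (Node r)"
    unfolding nnf_circuit_def
  proof (intro conjI allI impI)
    show "rooted_dag nnf_children ?N (Node r)" by (rule rooted_dag_expand[OF rooted])
    fix v M assume "?N v = Some (Conj M) \<or> ?N v = Some (Disj M)"
    then show "2 \<le> size M"
      using Conj_cases[of v M] Disj_cases[of v M] conds by (auto simp: decision_conditions_def)
  qed
  moreover have "decomposable ?N"
    unfolding decomposable_def
  proof (intro allI impI)
    fix v M u u' assume v: "?N v = Some (Conj M)" and sub: "{#u, u'#} \<subseteq># M"
    from Conj_cases[OF v] show "nnf_vars ?N u \<inter> nnf_vars ?N u' = {}"
    proof (elim disjE exE conjE)
      fix n M' assume n: "G n = Some (And M')" "M = image_mset Node M'"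
      then have "u \<in># image_mset Node M'" "u' \<in># image_mset Node M'"
        using set_mset_mono[OF sub] by simp_all
      then obtain m m' where m: "u = Node m" "u' = Node m'" by auto
      then have "image_mset Node {#m, m'#} \<subseteq># image_mset Node M'"
        using sub n by simp
      \<comment> \<open>Mapping a left inverse of \<open>Node\<close> over the inclusion pulls it
        back to \<open>M'\<close> with multiplicities intact. The values of the case expression off
        the constructor \<open>Node\<close> do not matter, since only \<open>Node\<close>
        occurs.\<close>
      from image_mset_subseteq_mono[OF this, of "\<lambda>v. case v of Node m \<Rightarrow> m"]
      have "{#m, m'#} \<subseteq># M'"
        by (simp add: multiset.map_comp comp_def)
      then show ?thesis
        using n(1) conds m by (auto simp: decision_conditions_def nnf_vars_expand_Node)
    next
      fix n x low high assume n: "G n = Some (Dec x low high)" "M = {#Leaf (Pos x), Node high#}"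
      then have "x \<notin> dvars G high"
        using conds unfolding decision_conditions_def by blast
      then show ?thesis
        using sub n nnf_vars_expand_Leaf[of G n "Pos x"]
        by (auto simp: pair_subset_pair nnf_vars_expand_Node)
    next
      fix n x low high assume n: "G n = Some (Dec x low high)" "M = {#Leaf (Neg x), Node low#}"
      then have "x \<notin> dvars G low"
        using conds unfolding decision_conditions_def by blast
      then show ?thesis
        using sub n nnf_vars_expand_Leaf[of G n "Neg x"]
        by (auto simp: pair_subset_pair nnf_vars_expand_Node)
    qed
  qed
  moreover have "deterministic ?N"
    unfolding deterministic_def
  proof (intro allI impI)
    fix v M u u' \<sigma> assume v: "?N v = Some (Disj M)" and sub: "{#u, u'#} \<subseteq># M"
    then show "\<not> (nnf_true ?N \<sigma> u \<and> nnf_true ?N \<sigma> u')"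
      using Disj_cases[OF v] not_nnf_true_Hi_Lo[of G \<sigma>] by (auto simp: pair_subset_pair)
  qed
  moreover have "decision_form ?N M" if v: "?N v = Some (Disj M)" for v M
  proof -
    obtain n x low high where n: "G n = Some (Dec x low high)" "M = {#Hi n, Lo n#}"
      using Disj_cases[OF v] by blast
    have "?N (Hi n) = Some (Conj {#Leaf (Pos x), Node high#})"
      "?N (Lo n) = Some (Conj {#Leaf (Neg x), Node low#})"
      "?N (Leaf (Pos x)) = Some (Lit (Pos x))" "?N (Leaf (Neg x)) = Some (Lit (Neg x))"
      using n expand_Leaf[of G n "Pos x"] expand_Leaf[of G n "Neg x"] by simp_all
    then show ?thesis using n unfolding decision_form_def by blast
  qed
  ultimately show ?thesis
    using rooted by (auto simp: decision_DNNF_drawing_def decision_DNNF_def d_DNNF_def)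
qed

section \<open>Returned circuits are reduced decision-DNNF\<close>

text \<open>The invariant of the table of unique nodes. It has no root, since the table also holds
  nodes made for other calls; a root appears only after restriction, in
  \<open>table_ok_returned\<close>.\<close>

definition table_ok :: "nat dag \<Rightarrow> bool" where
  "table_ok T \<longleftrightarrow> finite (dom T) \<and> (\<forall>l \<in> ran T. children l \<subseteq> dom T) \<and>
     acyclic (edges children T) \<and> reduced T \<and> decision_conditions T \<and>
     T zero_sink = Some (Sink False) \<and> T one_sink = Some (Sink True)"

fun node_ok :: "'n dag \<Rightarrow> 'n node \<Rightarrow> bool" where
  "node_ok T (Sink b) = True"
| "node_ok T (Dec x low high) = (low \<noteq> high \<and> x \<notin> dvars T low \<and> x \<notin> dvars T high)"
| "node_ok T (And M) = (size M \<ge> 2 \<and> (\<forall>m. count M m \<le> 1) \<and>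
     (\<forall>m m'. {#m, m'#} \<subseteq># M \<longrightarrow> dvars T m \<inter> dvars T m' = {}))"

text \<open>A closed graph has no edge into what is added, so old nodes reach the same nodes as
  before. Thus facts about a returned node survive all later calls.\<close>

lemma reach_extend:
  assumes closed: "\<forall>l \<in> ran T. ch l \<subseteq> dom T" and ext: "T \<subseteq>\<^sub>m T'" and n: "n \<in> dom T"
  shows "reach ch T' n = reach ch T n"
proof
  have dom: "reach ch T n \<subseteq> dom T"
    by (rule reach_subset_dom[OF n closed])
  have eq: "T' m = T m" if "m \<in> dom T" for m
    using ext that by (simp add: map_le_def)
  show "reach ch T' n \<subseteq> reach ch T n"
  proof (rule reach_subset)
    fix m l assume "m \<in> reach ch T n" "T' m = Some l"
    moreover from this have "T m = Some l" using eq[of m] dom by fastforce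
    ultimately show "ch l \<subseteq> reach ch T n" by (auto intro: reach_snoc)
  qed simp
  show "reach ch T n \<subseteq> reach ch T' n"
  proof (rule reach_subset)
    fix m l assume "m \<in> reach ch T' n" "T m = Some l"
    moreover from this(2) have "T' m = Some l" using eq[of m] by auto
    ultimately show "ch l \<subseteq> reach ch T' n" by (auto intro: reach_snoc)
  qed simp
qed

lemma dvars_extend:
  assumes closed: "\<forall>l \<in> ran T. children l \<subseteq> dom T" and ext: "T \<subseteq>\<^sub>m T'" and n: "n \<in> dom T"
  shows "dvars T' n = dvars T n"
proof -
  have "T' m = T m" if "m \<in> reach children T n" for m
  proof -
    have "m \<in> dom T" using reach_subset_dom[OF n closed] that by blast
    then show ?thesis using ext by (simp add: map_le_def)
  qed
  then show ?thesis
    unfolding dvars_def reach_extend[OF assms] by simp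
qed

lemma acyclic_edges_insert:
  assumes acyc: "acyclic (edges ch T)" and closed: "\<forall>l \<in> ran T. ch l \<subseteq> dom T"
    and r: "r \<notin> dom T" and l: "ch l \<subseteq> dom T"
  shows "acyclic (edges ch (T(r \<mapsto> l)))"
proof -
  \<comment> \<open>No path ends in the new node, and a path from an old node stays in the old
    graph. Hence a cycle would already be a cycle of \<open>T\<close>.\<close>
  have "y \<in> dom T \<and> (x \<in> dom T \<longrightarrow> (x, y) \<in> (edges ch T)\<^sup>+)"
    if "(x, y) \<in> (edges ch (T(r \<mapsto> l)))\<^sup>+" for x y
    using that
  proof induction
    case (base y)
    then show ?case using closed l r by (fastforce simp: mem_edges ran_def split: if_splits)
  next
    case (step y z)
    then have y: "y \<in> dom T" by simp
    then have "(y, z) \<in> edges ch T"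
      using step.hyps(2) r by (auto simp: mem_edges split: if_splits)
    moreover have "z \<in> dom T"
      using calculation closed by (force simp: mem_edges ran_def)
    ultimately show ?case using step.IH by (auto intro: trancl_into_trancl)
  qed
  then show ?thesis
    using acyc unfolding acyclic_def by blast
qed

lemma table_ok_closed: "table_ok T \<Longrightarrow> T n = Some l \<Longrightarrow> m \<in> children l \<Longrightarrow> m \<in> dom T"
  by (auto simp: table_ok_def ran_def)

text \<open>Every label of the extended table, old or new, points only to old nodes, whose
  \<open>dvars\<close> are unchanged. So the conditions can be checked label by label in
  \<open>T\<close>.\<close>

lemma table_ok_insert:
  assumes T: "table_ok T" and r: "r \<notin> dom T" and new: "l \<notin> ran T"
    and l: "children l \<subseteq> dom T" and ok: "node_ok T l"
  shows "table_ok (T(r \<mapsto> l))"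
proof -
  let ?T = "T(r \<mapsto> l)"
  have closed: "\<forall>l \<in> ran T. children l \<subseteq> dom T" and cond: "decision_conditions T"
    and red: "reduced T" and sinks: "T zero_sink = Some (Sink False)" "T one_sink = Some (Sink True)"
    using T by (auto simp: table_ok_def)
  have "T \<subseteq>\<^sub>m ?T" using r by (auto simp: map_le_def)
  then have dv: "dvars ?T n = dvars T n" if "n \<in> dom T" for n
    by (rule dvars_extend[OF closed _ that])
  have node_ok: "node_ok T k" if "T n = Some k" for n k
    using that red cond by (cases k) (auto simp: reduced_def decision_conditions_def)
  have node_ok': "children k \<subseteq> dom T \<and> node_ok T k" if "?T n = Some k" for n k
    using that ok l node_ok[of n k] table_ok_closed[OF T, of n k] by (auto split: if_splits)
  have "inj_on ?T (dom ?T)"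
    using red new r by (auto simp: reduced_def inj_on_def ran_def dest: sym)
  moreover have "decision_conditions ?T"
    unfolding decision_conditions_def
  proof (intro conjI allI impI)
    fix n x low high assume "?T n = Some (Dec x low high)"
    from node_ok'[OF this] show "x \<notin> dvars ?T low" "x \<notin> dvars ?T high"
      using dv by auto
  next
    fix n M assume n: "?T n = Some (And M)"
    from node_ok'[OF this] show "2 \<le> size M" by simp
    fix m m' assume sub: "{#m, m'#} \<subseteq># M"
    have "m \<in> dom T" "m' \<in> dom T"
      using set_mset_mono[OF sub] node_ok'[OF n] by auto
    then show "dvars ?T m \<inter> dvars ?T m' = {}"
      using node_ok'[OF n] sub dv by auto
  qed
  moreover have "low \<noteq> high" if "?T n = Some (Dec x low high)" for n x low high
    using node_ok'[OF that] by simp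
  moreover have "count M m \<le> 1" if "?T n = Some (And M)" for n M m
    using node_ok'[OF that] by simp
  ultimately have "reduced ?T" "decision_conditions ?T"
    unfolding reduced_def by blast+
  moreover have "acyclic (edges children ?T)"
    using T r l by (auto simp: table_ok_def intro!: acyclic_edges_insert)
  moreover have "\<forall>k \<in> ran ?T. children k \<subseteq> dom ?T"
    using node_ok' unfolding ran_def by fastforce
  moreover have "?T zero_sink = Some (Sink False)" "?T one_sink = Some (Sink True)"
    using sinks r by auto
  moreover have "finite (dom ?T)" using T by (simp add: table_ok_def)
  ultimately show ?thesis unfolding table_ok_def by blast
qed

lemma lookup_or_create_ok:
  assumes T: "table_ok T" and l: "children l \<subseteq> dom T" and ok: "node_ok T l"
    and look: "lookup_or_create l T r T'"
  shows "table_ok T' \<and> T \<subseteq>\<^sub>m T' \<and> r \<in> dom T' \<and>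
    dvars T' r = label_vars l \<union> (\<Union>m \<in> children l. dvars T m)"
proof -
  have *: "table_ok T' \<and> T \<subseteq>\<^sub>m T' \<and> T' r = Some l"
    using look table_ok_insert[OF T _ _ l ok] T
    by (auto simp: lookup_or_create_def map_le_def split: if_splits)
  moreover have "dvars T' m = dvars T m" if "m \<in> children l" for m
    using dvars_extend[of T T' m] T * l that by (auto simp: table_ok_def)
  ultimately show ?thesis using dvars_unfold[of T' r l] by auto
qed

text \<open>Restriction makes all nodes reachable from \<open>r\<close>. Labels stay as they are and
  \<open>dvars\<close> can only shrink, so the disjointness conditions are inherited.\<close>

lemma table_ok_returned:
  assumes T: "table_ok T" and r: "r \<in> dom T"
  shows "reduced (T |` reach children T r) \<and> decision_DNNF_drawing (T |` reach children T r) r"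
proof
  let ?R = "reach children T r" let ?G = "T |` ?R"
  have fin: "finite (dom T)" and closed: "\<forall>l \<in> ran T. children l \<subseteq> dom T"
    and acyc: "acyclic (edges children T)" and red: "reduced T" and cond: "decision_conditions T"
    using T by (auto simp: table_ok_def)
  have Some: "T n = Some l" if "?G n = Some l" for n l
    using that by (auto simp: restrict_map_def split: if_splits)
  have RT: "?R \<subseteq> dom T" by (rule reach_subset_dom[OF r closed])
  have dom: "dom ?G = ?R" using RT by auto
  show "reduced ?G"
    using red RT unfolding reduced_def dom
    by (auto simp: inj_on_def restrict_map_def subset_eq domIff split: if_splits)
  have "edges children ?G \<subseteq> edges children T"
    using Some by (fastforce simp: mem_edges)
  then have acyc': "acyclic (edges children ?G)"
    using acyc acyclic_subset by blast
  have reach: "reach children ?G n \<subseteq> reach children T n" for n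
    by (rule reach_subset) (auto dest: Some intro: reach_snoc)
  then have dv: "dvars ?G n \<subseteq> dvars T n" for n
    unfolding dvars_def by (auto dest!: Some)
  have "?R \<subseteq> reach children ?G r \<inter> ?R"
  proof (rule reach_subset)
    fix m l assume m: "m \<in> reach children ?G r \<inter> ?R" "T m = Some l"
    then have "?G m = Some l" by simp
    then show "children l \<subseteq> reach children ?G r \<inter> ?R"
      using m by (auto intro: reach_snoc)
  qed simp
  moreover have "children l \<subseteq> ?R" if "?G n = Some l" for n l
    using that by (auto simp: restrict_map_def split: if_splits intro: reach_snoc)
  ultimately have "rooted_dag children ?G r"
    unfolding rooted_dag_def dom using acyc' finite_subset[OF RT fin] by (auto simp: ran_def)
  moreover have "decision_conditions ?G"
    unfolding decision_conditions_def
  proof (intro conjI allI impI)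
    fix n x low high assume "?G n = Some (Dec x low high)"
    with Some cond have "x \<notin> dvars T low" "x \<notin> dvars T high"
      unfolding decision_conditions_def by blast+
    then show "x \<notin> dvars ?G low" "x \<notin> dvars ?G high" using dv by blast+
  next
    fix n M assume n: "?G n = Some (And M)"
    with Some cond show "2 \<le> size M" unfolding decision_conditions_def by blast
    fix m m' assume "{#m, m'#} \<subseteq># M"
    with n Some cond have "dvars T m \<inter> dvars T m' = {}"
      unfolding decision_conditions_def by blast
    then show "dvars ?G m \<inter> dvars ?G m' = {}" using dv[of m] dv[of m'] by blast
  qed
  ultimately show "decision_DNNF_drawing ?G r" by (rule drawing_if_conditions)
qed

section \<open>Runs of the algorithm preserve the invariant\<close>

lemma is_cnf_condition: "is_cnf \<Delta> \<Longrightarrow> is_cnf (condition \<Delta> x b)"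
  by (auto simp: is_cnf_def condition_def)

lemma vars_condition: "vars (condition \<Delta> x b) \<subseteq> vars \<Delta> - {x}"
proof
  fix y assume "y \<in> vars (condition \<Delta> x b)"
  then obtain c k where c: "c \<in> \<Delta>" "k \<in> c" "y = var_of k" "k \<noteq> Pos x" "k \<noteq> Neg x"
    by (cases b) (auto simp: vars_def condition_def)
  then have "var_of k \<noteq> x" by (cases k) auto
  then show "y \<in> vars \<Delta> - {x}" using c by (auto simp: vars_def)
qed

lemma componentsD:
  assumes "components \<Delta> \<Delta>s" "\<Delta>c \<in> set \<Delta>s"
  shows "\<Delta>c \<subseteq> \<Delta>" "vars \<Delta>c \<subseteq> vars \<Delta>" "is_cnf \<Delta> \<Longrightarrow> is_cnf \<Delta>c"
proof -
  show sub: "\<Delta>c \<subseteq> \<Delta>"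
    using assms by (auto simp: components_def partition_on_def)
  then show "vars \<Delta>c \<subseteq> vars \<Delta>" by (auto simp: vars_def)
  show "is_cnf \<Delta> \<Longrightarrow> is_cnf \<Delta>c"
    using sub by (auto simp: is_cnf_def intro: finite_subset)
qed

text \<open>A bound on variables, with no claim about models: this is what single testing of
  variables along paths and decomposability are derived from.\<close>

definition denotes :: "nat dag \<Rightarrow> nat \<Rightarrow> cnf \<Rightarrow> bool" where
  "denotes T r \<Delta> \<longleftrightarrow> r \<in> dom T \<and> dvars T r \<subseteq> vars \<Delta>"

text \<open>The condition ranges over all formulas with a cached key, because a hit may occur for a
  formula other than the one that was stored.\<close>

definition state_ok :: "(cnf \<Rightarrow> 'k) \<Rightarrow> 'k state \<Rightarrow> bool" where
  "state_ok key s \<longleftrightarrow> table_ok (fst s) \<and>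
     (\<forall>\<Delta> r. is_cnf \<Delta> \<longrightarrow> snd s (key \<Delta>) = Some r \<longrightarrow> denotes (fst s) r \<Delta>)"

lemma denotes_extend:
  assumes "denotes T r \<Delta>" "table_ok T" "T \<subseteq>\<^sub>m T'"
  shows "denotes T' r \<Delta>"
  using assms dvars_extend[of T T' r] map_le_implies_dom_le[of T T']
  by (auto simp: denotes_def table_ok_def)

lemma dvars_sink: "T n = Some (Sink b) \<Longrightarrow> dvars T n = {}"
  using dvars_unfold[of T n "Sink b"] by simp

lemma size_mset_set_not_singleton:
  assumes "finite R" "R \<noteq> {}" "\<not> is_singleton R"
  shows "size (mset_set R) \<ge> 2"
proof -
  have "card R \<noteq> 0" "card R \<noteq> 1"
    using assms by (auto simp: is_singleton_altdef)
  then show ?thesis by simp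
qed

lemma pair_subset_mset_set:
  assumes "{#m, m'#} \<subseteq># mset_set R" "finite R"
  shows "m \<in> R" "m' \<in> R" "m \<noteq> m'"
proof -
  show "m \<in> R" "m' \<in> R"
    using set_mset_mono[OF assms(1)] assms(2) by auto
  have "count {#m, m'#} m \<le> count (mset_set R) m"
    using assms(1) unfolding subseteq_mset_def by blast
  then show "m \<noteq> m'"
    using assms(2) by (auto simp: count_mset_set' split: if_splits)
qed

text \<open>Growth of the table is part of the claim, so that results of earlier calls remain valid
  in the final table. For lists, \<open>list_all2\<close> keeps each node paired with its component,
  which is the source of disjointness for and-nodes.\<close>

lemma dpll_sound:
  assumes key: "sound_key key"
  shows "dpll key s \<Delta> r s' \<Longrightarrow> is_cnf \<Delta> \<Longrightarrow> state_ok key s \<Longrightarrow>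
      state_ok key s' \<and> fst s \<subseteq>\<^sub>m fst s' \<and> denotes (fst s') r \<Delta>"
    and "dpll_list key s \<Delta>s rs s' \<Longrightarrow> \<forall>\<Delta> \<in> set \<Delta>s. is_cnf \<Delta> \<Longrightarrow> state_ok key s \<Longrightarrow>
      state_ok key s' \<and> fst s \<subseteq>\<^sub>m fst s' \<and> list_all2 (denotes (fst s')) rs \<Delta>s"
proof (induction rule: dpll_dpll_list.inducts)
  case (empty_clause \<Delta> s)
  then show ?case
    using dvars_sink[of "fst s" zero_sink False] dvars_sink[of "fst s" one_sink True]
    by (auto simp: state_ok_def table_ok_def denotes_def)
next
  case (no_variables \<Delta> s)
  then show ?case
    using dvars_sink[of "fst s" zero_sink False] dvars_sink[of "fst s" one_sink True]
    by (auto simp: state_ok_def table_ok_def denotes_def)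
next
  case (decompose \<Delta> \<Delta>s s rs T K r T')
  have IH: "state_ok key (T, K)" "fst s \<subseteq>\<^sub>m T" "list_all2 (denotes T) rs \<Delta>s"
    using decompose.IH decompose.prems componentsD[OF decompose.hyps(3)] by auto
  have len: "length rs = length \<Delta>s" using IH(3) by (rule list_all2_lengthD)
  have T: "table_ok T" using IH(1) by (simp add: state_ok_def)
  have den: "\<exists>i < length rs. m = rs ! i \<and> m \<in> dom T \<and> dvars T m \<subseteq> vars (\<Delta>s ! i)"
    if "m \<in> set rs" for m
  proof -
    from that obtain i where "i < length rs" "m = rs ! i" by (auto simp: in_set_conv_nth)
    then show ?thesis using IH(3) by (auto simp: list_all2_conv_all_nth denotes_def)
  qed
  have den': "denotes T m \<Delta>" if "m \<in> set rs" for m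
    using den[OF that] componentsD(2)[OF decompose.hyps(3)] len
    unfolding denotes_def by (metis nth_mem subset_trans)
  have res: "table_ok T' \<and> T \<subseteq>\<^sub>m T' \<and> denotes T' r \<Delta>"
    using decompose.hyps(5) unfolding get_and_node_def
  proof (elim disjE conjE)
    assume "set rs = {r}" "T' = T"
    then show ?thesis using den'[of r] T by auto
  next
    assume ns: "\<not> is_singleton (set rs)" and look: "lookup_or_create (And (mset_set (set rs))) T r T'"
    have "node_ok T (And (mset_set (set rs)))"
      unfolding node_ok.simps
    proof (intro conjI allI impI)
      show "2 \<le> size (mset_set (set rs))"
        using ns decompose.hyps(4) len by (intro size_mset_set_not_singleton) auto
      show "count (mset_set (set rs)) m \<le> 1" for m by (simp add: count_mset_set')
      fix m m' assume sub: "{#m, m'#} \<subseteq># mset_set (set rs)"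
      obtain i j where ij: "i < length rs" "m = rs ! i" "dvars T m \<subseteq> vars (\<Delta>s ! i)"
        "j < length rs" "m' = rs ! j" "dvars T m' \<subseteq> vars (\<Delta>s ! j)"
        using den pair_subset_mset_set(1,2)[OF sub] by (metis finite_set)
      \<comment> \<open>Different nodes sit at different positions, and the components are listed
        without repetition; so the two nodes come from different components, which share no
        variable.\<close>
      have "m \<noteq> m'" using pair_subset_mset_set(3)[OF sub] by simp
      then have "\<Delta>s ! i \<noteq> \<Delta>s ! j"
        using ij len decompose.hyps(3) by (auto simp: components_def nth_eq_iff_index_eq)
      then have "vars (\<Delta>s ! i) \<inter> vars (\<Delta>s ! j) = {}"
        using ij len decompose.hyps(3) by (auto simp: components_def disjoint_family_on_def)
      then show "dvars T m \<inter> dvars T m' = {}" using ij by blast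
    qed
    from lookup_or_create_ok[OF T _ this look] show ?thesis
      using den' by (auto simp: denotes_def)
  qed
  then have "state_ok key (T', K)"
    using IH(1) denotes_extend[OF _ T] by (simp add: state_ok_def)
  then show ?case using res IH(2) by (auto intro: map_le_trans)
next
  case (cache_hit \<Delta> K r T)
  then show ?case by (auto simp: state_ok_def)
next
  case (branch \<Delta> x K T low s1 high T2 K2 r T3)
  note cnf = is_cnf_condition[OF branch.prems(1)]
  have 1: "state_ok key s1" "T \<subseteq>\<^sub>m fst s1" "denotes (fst s1) low (condition \<Delta> x False)"
    using branch.IH(3)[OF cnf branch.prems(2)] by auto
  have 2: "state_ok key (T2, K2)" "fst s1 \<subseteq>\<^sub>m T2" "denotes T2 high (condition \<Delta> x True)"
    using branch.IH(5)[OF cnf 1(1)] by auto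
  have T2: "table_ok T2" using 2(1) by (simp add: state_ok_def)
  have low: "denotes T2 low (condition \<Delta> x False)"
    using 1 2 by (auto simp: state_ok_def intro: denotes_extend)
  have notin: "x \<notin> dvars T2 low" "x \<notin> dvars T2 high"
    and sub: "dvars T2 low \<subseteq> vars \<Delta>" "dvars T2 high \<subseteq> vars \<Delta>"
    using low 2(3) vars_condition[of \<Delta> x] by (auto simp: denotes_def)
  have res: "table_ok T3 \<and> T2 \<subseteq>\<^sub>m T3 \<and> denotes T3 r \<Delta>"
  proof (cases "low = high")
    case True
    then show ?thesis
      using \<open>get_node x low high T2 r T3\<close> low T2 sub by (auto simp: get_node_def denotes_def)
  next
    case False
    then have look: "lookup_or_create (Dec x low high) T2 r T3"
      using \<open>get_node x low high T2 r T3\<close> by (simp add: get_node_def)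
    have "node_ok T2 (Dec x low high)" using False notin by simp
    from lookup_or_create_ok[OF T2 _ this look] show ?thesis
      using low 2(3) sub \<open>x \<in> vars \<Delta>\<close> by (auto simp: denotes_def)
  qed
  \<comment> \<open>A formula whose key equals that of \<open>\<Delta>\<close> has the same
    variables, so the bound obtained for \<open>\<Delta>\<close> applies to it; other entries are
    carried over from \<open>K2\<close>.\<close>
  have "denotes T3 r' \<Delta>'" if "is_cnf \<Delta>'" "(K2(key \<Delta> \<mapsto> r)) (key \<Delta>') = Some r'" for \<Delta>' r'
  proof (cases "key \<Delta>' = key \<Delta>")
    case True
    then have "vars \<Delta>' = vars \<Delta>"
      using key that(1) branch.prems(1) unfolding sound_key_def by blast
    moreover have "r' = r" using True that(2) by simp
    ultimately show ?thesis using res by (simp add: denotes_def)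
  next
    case False
    then show ?thesis
      using that 2(1) res denotes_extend[OF _ T2, of r' \<Delta>' T3] by (simp add: state_ok_def)
  qed
  then have "state_ok key (T3, K2(key \<Delta> \<mapsto> r))"
    using res by (simp add: state_ok_def)
  then show ?case using res 1(2) 2(2) by (auto intro: map_le_trans)
next
  case (list_nil s)
  then show ?case by simp
next
  case (list_cons s \<Delta> r s1 \<Delta>s rs s2)
  then have 1: "state_ok key s1" "fst s \<subseteq>\<^sub>m fst s1" "denotes (fst s1) r \<Delta>"
    and 2: "state_ok key s2" "fst s1 \<subseteq>\<^sub>m fst s2" "list_all2 (denotes (fst s2)) rs \<Delta>s"
    by auto
  have "denotes (fst s2) r \<Delta>"
    using 1 2 by (auto simp: state_ok_def intro: denotes_extend)
  then show ?case using 1 2 by (auto intro: map_le_trans)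
qed

lemma state_ok_init: "state_ok key init_state"
proof -
  let ?T = "[zero_sink \<mapsto> Sink False, one_sink \<mapsto> Sink True] :: nat dag"
  have sink: "\<exists>b. l = Sink b" if "?T n = Some l" for n l
    using that by (auto split: if_splits)
  have "edges children ?T = {}"
    using sink by (fastforce simp: mem_edges)
  then have "acyclic (edges children ?T)" by (simp add: acyclic_def)
  moreover have "reduced ?T"
    unfolding reduced_def
    by (auto simp: inj_on_def split: if_splits)
  moreover have "decision_conditions ?T"
    unfolding decision_conditions_def by auto
  ultimately have "table_ok ?T"
    using sink by (fastforce simp: table_ok_def ran_def zero_sink_def one_sink_def)
  then show ?thesis by (simp add: state_ok_def init_state_def)
qed

lemma dpll_returns_reduced_drawing:
  assumes "sound_key key" "is_cnf \<Delta>" "dpll_returns key \<Delta> G r"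
  shows "reduced G \<and> decision_DNNF_drawing G r"
proof -
  obtain T K where run: "dpll key init_state \<Delta> r (T, K)" and G: "G = T |` reach children T r"
    using assms(3) by (auto simp: dpll_returns_def)
  have "state_ok key (T, K)" "denotes T r \<Delta>"
    using dpll_sound(1)[OF assms(1) run assms(2) state_ok_init] by auto
  then show ?thesis
    unfolding G by (intro table_ok_returned) (auto simp: state_ok_def denotes_def)
qed

section \<open>Every reduced decision-DNNF is returned\<close>

text \<open>Renaming children loses nothing when the naming is injective on them. Hence a table
  lookup cannot confuse two differently labeled nodes of the circuit.\<close>

lemma node_map_node_eq:
  assumes "inj_on f A" "children k \<subseteq> A" "children l \<subseteq> A" "map_node f k = map_node f l"
  shows "k = l"
  using assms by (intro node.inj_map_strong[of k l f f]) (auto dest: inj_onD)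

text \<open>Keys are opaque, so the variables of a cache entry are those of a witness formula; for a
  sound key they do not depend on the witness.\<close>

definition avoids :: "(cnf \<Rightarrow> 'k) \<Rightarrow> ('k \<rightharpoonup> nat) \<Rightarrow> var set \<Rightarrow> bool" where
  "avoids key K D \<longleftrightarrow> (\<forall>k \<in> dom K. \<exists>\<Delta>. is_cnf \<Delta> \<and> key \<Delta> = k \<and> vars \<Delta> \<inter> D = {})"

lemma avoids_mono: "avoids key K D \<Longrightarrow> D' \<subseteq> D \<Longrightarrow> avoids key K D'"
  unfolding avoids_def by blast

lemma avoids_update:
  "avoids key K D \<Longrightarrow> is_cnf \<Delta> \<Longrightarrow> vars \<Delta> \<inter> D = {} \<Longrightarrow> avoids key (K(key \<Delta> \<mapsto> r)) D"
  unfolding avoids_def by auto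

text \<open>The argument that excludes cache hits: a stored formula with the same key would have to
  mention a variable of \<open>D\<close>.\<close>

lemma avoids_None:
  assumes "sound_key key" "is_cnf \<Delta>" "avoids key K D" "vars \<Delta> \<inter> D \<noteq> {}"
  shows "K (key \<Delta>) = None"
proof (rule ccontr)
  assume "K (key \<Delta>) \<noteq> None"
  then obtain \<Delta>' where "is_cnf \<Delta>'" "key \<Delta>' = key \<Delta>" "vars \<Delta>' \<inter> D = {}"
    using assms(3) by (auto simp: avoids_def dom_def)
  moreover from this have "vars \<Delta>' = vars \<Delta>"
    using assms(1,2) unfolding sound_key_def by blast
  ultimately show False using assms(4) by simp
qed

section \<open>Formulas for decision nodes and sinks\<close>

lemma vars_nonempty: "{} \<notin> \<Delta> \<Longrightarrow> \<Delta> \<noteq> {} \<Longrightarrow> vars \<Delta> \<noteq> {}"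
  by (auto simp: vars_def)

text \<open>The tautological clause disappears under either value of \<open>x\<close>; its variable \<open>a\<close>
  distinguishes the formula from all others that the run puts into the cache.\<close>

definition dec_cnf :: "var \<Rightarrow> var \<Rightarrow> cnf \<Rightarrow> cnf \<Rightarrow> cnf" where
  "dec_cnf a x \<Delta>0 \<Delta>1 =
     insert {Pos x, Neg x, Pos a} (insert (Pos x) ` \<Delta>0 \<union> insert (Neg x) ` \<Delta>1)"

lemma vars_dec_cnf: "vars (dec_cnf a x \<Delta>0 \<Delta>1) = {a, x} \<union> vars \<Delta>0 \<union> vars \<Delta>1"
  by (auto simp: vars_def dec_cnf_def)

lemma is_cnf_dec_cnf: "is_cnf \<Delta>0 \<Longrightarrow> is_cnf \<Delta>1 \<Longrightarrow> is_cnf (dec_cnf a x \<Delta>0 \<Delta>1)"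
  by (auto simp: is_cnf_def dec_cnf_def)

text \<open>Setting \<open>x\<close> to 0 satisfies the tautology and the clauses from
  \<open>\<Delta>1\<close>, and strips \<open>Pos x\<close> from those of \<open>\<Delta>0\<close>;
  since \<open>x\<close> does not occur in \<open>\<Delta>0\<close>, exactly
  \<open>\<Delta>0\<close> is left. The case of 1 is symmetric.\<close>

lemma condition_dec_cnf:
  assumes "x \<notin> vars \<Delta>0" "x \<notin> vars \<Delta>1"
  shows "condition (dec_cnf a x \<Delta>0 \<Delta>1) x False = \<Delta>0"
    "condition (dec_cnf a x \<Delta>0 \<Delta>1) x True = \<Delta>1"
proof -
  have "var_of k \<in> vars \<Delta>0 \<union> vars \<Delta>1" if "k \<in> d" "d \<in> \<Delta>0 \<union> \<Delta>1" for k d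
    using that by (auto simp: vars_def)
  from this[of "Pos x"] this[of "Neg x"]
  have no: "Pos x \<notin> d" "Neg x \<notin> d" if "d \<in> \<Delta>0 \<union> \<Delta>1" for d
    using that assms by auto
  have "{d \<in> dec_cnf a x \<Delta>0 \<Delta>1. Neg x \<notin> d} = insert (Pos x) ` \<Delta>0"
    "{d \<in> dec_cnf a x \<Delta>0 \<Delta>1. Pos x \<notin> d} = insert (Neg x) ` \<Delta>1"
    unfolding dec_cnf_def using no by blast+
  moreover have "(\<lambda>d. insert (Pos x) d - {Pos x}) ` \<Delta>0 = (\<lambda>d. d) ` \<Delta>0"
    "(\<lambda>d. insert (Neg x) d - {Neg x}) ` \<Delta>1 = (\<lambda>d. d) ` \<Delta>1"
    using no by (intro image_cong; simp)+
  ultimately show "condition (dec_cnf a x \<Delta>0 \<Delta>1) x False = \<Delta>0"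
    "condition (dec_cnf a x \<Delta>0 \<Delta>1) x True = \<Delta>1"
    by (simp_all add: condition_def image_image)
qed

text \<open>A sink may be a child of an and-node, where neither the empty formula nor the empty
  clause can stand for it. A tautology or contradiction in its own variable can: both branches
  return the same sink, and \<open>get_node\<close> passes it on.\<close>

definition sink_cnf :: "var \<Rightarrow> bool \<Rightarrow> cnf" where
  "sink_cnf a b = (if b then {{Pos a, Neg a}} else {{Pos a}, {Neg a}})"

lemma sink_cnf_simps:
  "is_cnf (sink_cnf a b)" "{} \<notin> sink_cnf a b" "sink_cnf a b \<noteq> {}" "vars (sink_cnf a b) = {a}"
  "condition (sink_cnf a b) a v = (if b then {} else {{}})"
  by (auto simp: is_cnf_def sink_cnf_def vars_def condition_def)

lemma dpll_sink_cnf: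
  assumes "K (key (sink_cnf a b)) = None"
  shows "dpll key (T, K) (sink_cnf a b) (if b then one_sink else zero_sink)
    (T, K(key (sink_cnf a b) \<mapsto> (if b then one_sink else zero_sink)))"
proof -
  have "dpll key (T, K) (condition (sink_cnf a b) a v) (if b then one_sink else zero_sink) (T, K)"
    for v
    unfolding sink_cnf_simps
    by (auto intro: empty_clause no_variables simp: vars_def)
  from branch[OF _ _ assms this this] show ?thesis
    by (simp add: sink_cnf_simps get_node_def)
qed

text \<open>Numbers from \<open>B\<close> on label no decision node of \<open>C\<close>; they are
  the supply of fresh variables.\<close>

locale reduced_circuit =
  fixes key :: "cnf \<Rightarrow> 'k" and C :: "'n dag" and c :: 'n and B :: nat
  assumes key: "sound_key key" and red: "reduced C" and drawing: "decision_DNNF_drawing C c"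
    and bound: "dvars C n \<subseteq> {..<B}"
begin

lemma dag: "finite (dom C)" "\<forall>l \<in> ran C. children l \<subseteq> dom C" "acyclic (edges children C)"
  "c \<in> dom C" "dom C \<subseteq> reach children C c"
  using drawing by (auto simp: decision_DNNF_drawing_def rooted_dag_def)

lemma cond: "decision_conditions C"
  using drawing by (rule drawing_imp_conditions)

text \<open>The node table \<open>T\<close> is a copy under \<open>g\<close> of the part \<open>S\<close> of \<open>C\<close>, apart from the two sinks,
  which are always present.\<close>

definition sim :: "'n set \<Rightarrow> ('n \<Rightarrow> nat) \<Rightarrow> nat dag \<Rightarrow> bool" where
  "sim S g T \<longleftrightarrow> S \<subseteq> dom C \<and> (\<forall>n \<in> S. \<forall>l. C n = Some l \<longrightarrow> children l \<subseteq> S) \<and>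
     (\<forall>n b. C n = Some (Sink b) \<longrightarrow> n \<in> S \<and> g n = (if b then one_sink else zero_sink)) \<and>
     inj_on g S \<and> (\<forall>n \<in> S. T (g n) = map_option (map_node g) (C n)) \<and>
     dom T = g ` S \<union> {zero_sink, one_sink} \<and>
     T zero_sink = Some (Sink False) \<and> T one_sink = Some (Sink True)"

text \<open>Lookup reproduces the sharing of \<open>C\<close>: the label of a copied node is found
  in the table, and that of an uncopied node is absent, because \<open>C\<close> has no two nodes
  with equal labels and \<open>g\<close> is injective.\<close>

lemma sim_node:
  assumes sim: "sim S g T" and n: "C n = Some l" and l: "children l \<subseteq> S" and ns: "\<And>b. l \<noteq> Sink b"
  shows "\<exists>g' T'. lookup_or_create (map_node g l) T (g' n) T' \<and> sim (insert n S) g' T' \<and>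
    (\<forall>m \<in> S. g' m = g m)"
proof (cases "n \<in> S")
  case True
  then have "T (g n) = Some (map_node g l)" using sim n by (simp add: sim_def)
  then have "lookup_or_create (map_node g l) T (g n) T"
    by (auto simp: lookup_or_create_def ran_def)
  then show ?thesis using sim True by (auto simp: insert_absorb)
next
  case False
  have inj: "inj_on g S" and dom: "dom T = g ` S \<union> {zero_sink, one_sink}" and SC: "S \<subseteq> dom C"
    and T: "\<And>m. m \<in> S \<Longrightarrow> T (g m) = map_option (map_node g) (C m)"
    and closed: "\<And>m k. m \<in> S \<Longrightarrow> C m = Some k \<Longrightarrow> children k \<subseteq> S"
    and sinks: "T zero_sink = Some (Sink False)" "T one_sink = Some (Sink True)"
    using sim by (auto simp: sim_def)
  have new: "map_node g l \<notin> ran T"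
  proof
    assume "map_node g l \<in> ran T"
    then obtain r where r: "T r = Some (map_node g l)" by (auto simp: ran_def)
    \<comment> \<open>The table may hold a sink that is no image of a node of \<open>C\<close>. As
      \<open>l\<close> is not a sink, the entry found must be a copied node.\<close>
    have "map_node g l \<noteq> Sink b" for b using ns by (cases l) auto
    then have "r \<noteq> zero_sink" "r \<noteq> one_sink" using r sinks by (metis option.inject)+
    then obtain m where m: "m \<in> S" "r = g m" using dom r by blast
    then obtain k where k: "C m = Some k" using SC by blast
    then have "map_node g k = map_node g l" using T[OF m(1)] r m by simp
    then have "k = l" using node_map_node_eq[OF inj closed[OF m(1) k] l] by simp
    then have "m = n" using red k n by (auto simp: reduced_def intro: inj_onD[of C "dom C" m n])
    then show False using m False by simp
  qed
  have "finite (dom T)" using dom SC dag(1) finite_subset by fastforce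
  then obtain r where r: "r \<notin> dom T" using ex_new_if_finite infinite_UNIV_nat by blast
  let ?g = "g(n := r)"
  have eq: "map_node ?g k = map_node g k" if "children k \<subseteq> S" for k
    using that False by (intro node.map_cong) auto
  have "lookup_or_create (map_node g l) T (?g n) (T(r \<mapsto> map_node g l))"
    using new r by (simp add: lookup_or_create_def)
  moreover have "sim (insert n S) ?g (T(r \<mapsto> map_node g l))"
    unfolding sim_def
  proof (intro conjI ballI allI impI)
    show "insert n S \<subseteq> dom C" using SC n by auto
    show "children k \<subseteq> insert n S" if "m \<in> insert n S" "C m = Some k" for m k
      using that closed n l by auto
    show "m \<in> insert n S" "?g m = (if b then one_sink else zero_sink)"
      if "C m = Some (Sink b)" for m b
      using that sim n ns by (auto simp: sim_def)
    have "r \<notin> g ` S" using r dom by auto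
    then show "inj_on ?g (insert n S)" using inj False by (auto simp: inj_on_def)
    show "(T(r \<mapsto> map_node g l)) (?g m) = map_option (map_node ?g) (C m)" if "m \<in> insert n S" for m
    proof (cases "m = n")
      case True
      then show ?thesis using n eq[OF l] by simp
    next
      case neq: False
      then have m: "m \<in> S" using that by simp
      then have "g m \<noteq> r" using dom r by auto
      then show ?thesis using neq T[OF m] eq closed[OF m] by (cases "C m") auto
    qed
    show "dom (T(r \<mapsto> map_node g l)) = ?g ` insert n S \<union> {zero_sink, one_sink}"
      using dom False by auto
    show "(T(r \<mapsto> map_node g l)) zero_sink = Some (Sink False)"
      "(T(r \<mapsto> map_node g l)) one_sink = Some (Sink True)"
      using sinks r by auto
  qed
  ultimately show ?thesis using False by (intro exI[of _ ?g] exI) auto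
qed

text \<open>\<open>Q\<close> abstracts a run between two states that uses \<open>g\<close> to name the nodes \<open>N\<close> it returns.
  The formulas it caches have their variables in \<open>V\<close>, and it can start from any cache whose
  formulas avoid the fresh variables \<open>D\<close>.\<close>

definition realizes ::
  "('k state \<Rightarrow> ('n \<Rightarrow> nat) \<Rightarrow> 'k state \<Rightarrow> bool) \<Rightarrow> 'n set \<Rightarrow> var set \<Rightarrow> var set \<Rightarrow> bool" where
  "realizes Q N V D \<longleftrightarrow> (\<forall>S g T K. sim S g T \<longrightarrow> avoids key K D \<longrightarrow>
     (\<exists>S' g' T' K'. Q (T, K) g' (T', K') \<and> sim S' g' T' \<and> S \<union> N \<subseteq> S' \<and> (\<forall>n \<in> S. g' n = g n) \<and>
        (\<forall>E. E \<inter> V = {} \<longrightarrow> avoids key K E \<longrightarrow> avoids key K' E)))"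

lemma realizesD:
  assumes "realizes Q N V D" "sim S g T" "avoids key K D"
  obtains S' g' T' K' where "Q (T, K) g' (T', K')" "sim S' g' T'" "S \<subseteq> S'" "N \<subseteq> S'"
    "\<And>n. n \<in> S \<Longrightarrow> g' n = g n" "\<And>E. E \<inter> V = {} \<Longrightarrow> avoids key K E \<Longrightarrow> avoids key K' E"
  using assms unfolding realizes_def by (metis le_sup_iff)

lemma realizes_mono:
  assumes "realizes Q N V D" "\<And>s g s'. Q s g s' \<Longrightarrow> Q' s g s'"
  shows "realizes Q' N V D"
  unfolding realizes_def
proof (intro allI impI)
  fix S g T K assume "sim S g T" "avoids key K D"
  from realizesD[OF assms(1) this] obtain S' g' T' K' where "Q (T, K) g' (T', K')" "sim S' g' T'"
    "S \<subseteq> S'" "N \<subseteq> S'" "\<And>n. n \<in> S \<Longrightarrow> g' n = g n"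
    "\<And>E. E \<inter> V = {} \<Longrightarrow> avoids key K E \<Longrightarrow> avoids key K' E" by metis
  then show "\<exists>S' g' T' K'. Q' (T, K) g' (T', K') \<and> sim S' g' T' \<and> S \<union> N \<subseteq> S' \<and>
      (\<forall>n\<in>S. g' n = g n) \<and> (\<forall>E. E \<inter> V = {} \<longrightarrow> avoids key K E \<longrightarrow> avoids key K' E)"
    using assms(2) by (intro exI[of _ S'] exI[of _ g'] exI[of _ T'] exI[of _ K']) auto
qed

text \<open>The first run caches only formulas over \<open>V1\<close>, so the cache still avoids
  \<open>D2\<close> when the second run starts. The second run extends the naming, and
  \<open>cong\<close> allows the first run to be restated with the extended one.\<close>

lemma realizes_seq:
  assumes Q1: "realizes Q1 N1 V1 D1" and Q2: "realizes Q2 N2 V2 D2" and VD: "V1 \<inter> D2 = {}"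
    and sub: "D1 \<union> D2 \<subseteq> D"
    and cong: "\<And>s g g' s'. (\<And>n. n \<in> N1 \<Longrightarrow> g n = g' n) \<Longrightarrow> Q1 s g s' \<Longrightarrow> Q1 s g' s'"
  shows "realizes (\<lambda>s g s2. \<exists>s1. Q1 s g s1 \<and> Q2 s1 g s2) (N1 \<union> N2) (V1 \<union> V2) D"
  unfolding realizes_def
proof (intro allI impI)
  fix S g T K assume sim: "sim S g T" and av: "avoids key K D"
  have av1: "avoids key K D1" and av2: "avoids key K D2" using av sub by (auto intro: avoids_mono)
  obtain S1 g1 T1 K1 where 1: "Q1 (T, K) g1 (T1, K1)" "sim S1 g1 T1" "S \<subseteq> S1" "N1 \<subseteq> S1"
    "\<And>n. n \<in> S \<Longrightarrow> g1 n = g n" "\<And>E. E \<inter> V1 = {} \<Longrightarrow> avoids key K E \<Longrightarrow> avoids key K1 E"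
    using realizesD[OF Q1 sim av1] by metis
  have "avoids key K1 D2" using 1(6) av2 VD by blast
  from realizesD[OF Q2 1(2) this]
  obtain S2 g2 T2 K2 where 2: "Q2 (T1, K1) g2 (T2, K2)" "sim S2 g2 T2" "S1 \<subseteq> S2" "N2 \<subseteq> S2"
    "\<And>n. n \<in> S1 \<Longrightarrow> g2 n = g1 n" "\<And>E. E \<inter> V2 = {} \<Longrightarrow> avoids key K1 E \<Longrightarrow> avoids key K2 E"
    by metis
  have "Q1 (T, K) g2 (T1, K1)"
    by (rule cong[OF _ 1(1)]) (use 1(4) 2(5) in auto)
  moreover have "avoids key K2 E" if "E \<inter> (V1 \<union> V2) = {}" "avoids key K E" for E
  proof (rule 2(6))
    show "E \<inter> V2 = {}" using that(1) by blast
    show "avoids key K1 E" by (rule 1(6)) (use that in blast)+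
  qed
  moreover have "S \<union> (N1 \<union> N2) \<subseteq> S2" using 1(3,4) 2(3,4) by blast
  moreover have "g2 n = g n" if "n \<in> S" for n using 1(3,5) 2(5) that by auto
  ultimately show "\<exists>S' g' T' K'. (\<exists>s1. Q1 (T, K) g' s1 \<and> Q2 s1 g' (T', K')) \<and> sim S' g' T' \<and>
      S \<union> (N1 \<union> N2) \<subseteq> S' \<and> (\<forall>n\<in>S. g' n = g n) \<and>
      (\<forall>E. E \<inter> (V1 \<union> V2) = {} \<longrightarrow> avoids key K E \<longrightarrow> avoids key K' E)"
    using 2(1,2) by blast
qed

text \<open>Fresh variables are threaded like a counter: \<open>a\<close> is the first one
  available, \<open>b\<close> the first one left over. A nonempty formula without empty clause can
  be a component, and the first two rules of \<open>dpll\<close> do not end its call.\<close>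

definition generates :: "'n \<Rightarrow> nat \<Rightarrow> nat \<Rightarrow> cnf \<Rightarrow> bool" where
  "generates n a b \<Delta> \<longleftrightarrow> a \<le> b \<and> is_cnf \<Delta> \<and> {} \<notin> \<Delta> \<and> \<Delta> \<noteq> {} \<and>
     vars \<Delta> \<subseteq> dvars C n \<union> {a..<b} \<and>
     realizes (\<lambda>s g s'. dpll key s \<Delta> (g n) s') {n} (vars \<Delta>) {a..<b}"

text \<open>Disjointness is required between positions of the list; together with nonempty variable
  sets this also excludes repeated formulas.\<close>

definition generates_list :: "'n list \<Rightarrow> nat \<Rightarrow> nat \<Rightarrow> cnf list \<Rightarrow> bool" where
  "generates_list ns a b \<Delta>s \<longleftrightarrow> a \<le> b \<and> length \<Delta>s = length ns \<and>
     (\<forall>\<Delta> \<in> set \<Delta>s. is_cnf \<Delta> \<and> {} \<notin> \<Delta> \<and> \<Delta> \<noteq> {}) \<and>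
     sorted_wrt (\<lambda>\<Delta> \<Delta>'. vars \<Delta> \<inter> vars \<Delta>' = {}) \<Delta>s \<and>
     (\<Union>\<Delta> \<in> set \<Delta>s. vars \<Delta>) \<subseteq> (\<Union>n \<in> set ns. dvars C n) \<union> {a..<b} \<and>
     realizes (\<lambda>s g s'. dpll_list key s \<Delta>s (map g ns) s') (set ns) (\<Union>\<Delta> \<in> set \<Delta>s. vars \<Delta>) {a..<b}"

section \<open>Construction of a formula for every node of the circuit\<close>

lemma dvars_fresh: "B \<le> a \<Longrightarrow> dvars C n \<inter> {a..<b} = {}"
  using bound by fastforce

lemma generates_sink:
  assumes n: "C n = Some (Sink v)"
  shows "generates n a (Suc a) (sink_cnf a v)"
proof -
  have "realizes (\<lambda>s g s'. dpll key s (sink_cnf a v) (g n) s') {n} {a} {a..<Suc a}"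
    unfolding realizes_def
  proof (intro allI impI)
    fix S g T K assume sim: "sim S g T" and av: "avoids key K {a..<Suc a}"
    have gn: "n \<in> S" "g n = (if v then one_sink else zero_sink)"
      using sim n by (auto simp: sim_def)
    let ?K = "K(key (sink_cnf a v) \<mapsto> g n)"
    have "K (key (sink_cnf a v)) = None"
      by (rule avoids_None[OF key _ av]) (simp_all add: sink_cnf_simps)
    from dpll_sink_cnf[of K key a v, OF this] have "dpll key (T, K) (sink_cnf a v) (g n) (T, ?K)"
      unfolding gn(2) .
    moreover have "avoids key ?K E" if "E \<inter> {a} = {}" "avoids key K E" for E
      using that by (intro avoids_update) (auto simp: sink_cnf_simps)
    ultimately show "\<exists>S' g' T' K'. dpll key (T, K) (sink_cnf a v) (g' n) (T', K') \<and> sim S' g' T' \<and>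
        S \<union> {n} \<subseteq> S' \<and> (\<forall>n\<in>S. g' n = g n) \<and>
        (\<forall>E. E \<inter> {a} = {} \<longrightarrow> avoids key K E \<longrightarrow> avoids key K' E)"
      using sim gn(1) by (intro exI[of _ S] exI[of _ g] exI[of _ T] exI[of _ ?K]) auto
  qed
  then show ?thesis by (simp add: generates_def sink_cnf_simps)
qed

text \<open>The node owns \<open>a\<close>, the low child gets \<open>{Suc a..<b}\<close> and the
  high child \<open>{b..<d}\<close>. The formula for the low child avoids the latter interval, so
  the two runs can be composed.\<close>

lemma generates_dec:
  assumes n: "C n = Some (Dec x low high)" and a: "B \<le> a"
    and low: "generates low (Suc a) b \<Delta>0" and high: "generates high b d \<Delta>1"
  shows "generates n a d (dec_cnf a x \<Delta>0 \<Delta>1)"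
proof -
  let ?\<Delta> = "dec_cnf a x \<Delta>0 \<Delta>1"
  have le: "Suc a \<le> b" "b \<le> d"
    and vars0: "vars \<Delta>0 \<subseteq> dvars C low \<union> {Suc a..<b}" and vars1: "vars \<Delta>1 \<subseteq> dvars C high \<union> {b..<d}"
    and cnf: "is_cnf \<Delta>0" "is_cnf \<Delta>1"
    and real0: "realizes (\<lambda>s g s'. dpll key s \<Delta>0 (g low) s') {low} (vars \<Delta>0) {Suc a..<b}"
    and real1: "realizes (\<lambda>s g s'. dpll key s \<Delta>1 (g high) s') {high} (vars \<Delta>1) {b..<d}"
    using low high by (auto simp: generates_def)
  have dv: "dvars C n = {x} \<union> dvars C low \<union> dvars C high"
    using dvars_unfold[of C n, OF n] by auto
  have "x < B" using bound[of n] dv by auto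
  then have x: "x \<notin> vars \<Delta>0" "x \<notin> vars \<Delta>1"
    using cond n vars0 vars1 le a by (fastforce simp: decision_conditions_def)+
  have vars: "vars ?\<Delta> \<subseteq> dvars C n \<union> {a..<d}"
    using vars0 vars1 le unfolding vars_dec_cnf dv by auto
  have is_cnf: "is_cnf ?\<Delta>" by (rule is_cnf_dec_cnf[OF cnf])
  have disj: "vars \<Delta>0 \<inter> {b..<d} = {}"
    using vars0 dvars_fresh[of b low d] a le by fastforce
  have seq: "realizes (\<lambda>s g s2. \<exists>s1. dpll key s \<Delta>0 (g low) s1 \<and> dpll key s1 \<Delta>1 (g high) s2)
      ({low} \<union> {high}) (vars \<Delta>0 \<union> vars \<Delta>1) {a..<d}"
    by (rule realizes_seq[OF real0 real1 disj]) (use le in auto)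
  have "realizes (\<lambda>s g s'. dpll key s ?\<Delta> (g n) s') {n} (vars ?\<Delta>) {a..<d}"
    unfolding realizes_def
  proof (intro allI impI)
    fix S g T K assume sim: "sim S g T" and av: "avoids key K {a..<d}"
    from realizesD[OF seq this]
    obtain S1 g1 T1 K1 where
      run: "\<exists>s1. dpll key (T, K) \<Delta>0 (g1 low) s1 \<and> dpll key s1 \<Delta>1 (g1 high) (T1, K1)"
      and 1: "sim S1 g1 T1" "S \<subseteq> S1" "{low} \<union> {high} \<subseteq> S1" "\<And>n. n \<in> S \<Longrightarrow> g1 n = g n"
        "\<And>E. E \<inter> (vars \<Delta>0 \<union> vars \<Delta>1) = {} \<Longrightarrow> avoids key K E \<Longrightarrow> avoids key K1 E"
      by metis
    obtain g' T' where look: "lookup_or_create (map_node g1 (Dec x low high)) T1 (g' n) T'"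
      and 2: "sim (insert n S1) g' T'" "\<forall>m \<in> S1. g' m = g1 m"
      using sim_node[OF 1(1) n] 1(3) by auto
    \<comment> \<open>Reducedness and injectivity of \<open>g1\<close> exclude the case in which
      \<open>get_node\<close> collapses the node.\<close>
    have "low \<noteq> high" using red n by (auto simp: reduced_def)
    then have "g1 low \<noteq> g1 high" using 1(1,3) by (auto simp: sim_def dest: inj_onD)
    then have get: "get_node x (g1 low) (g1 high) T1 (g' n) T'"
      using look by (simp add: get_node_def)
    \<comment> \<open>The variable \<open>a\<close> occurs in the formula and lies in the interval
      that the cache avoids.\<close>
    have "K (key ?\<Delta>) = None"
      by (rule avoids_None[OF key is_cnf av]) (use le in \<open>simp add: vars_dec_cnf\<close>)
    moreover have "{} \<notin> ?\<Delta>" by (auto simp: dec_cnf_def)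
    moreover have "x \<in> vars ?\<Delta>" by (simp add: vars_dec_cnf)
    ultimately have "dpll key (T, K) ?\<Delta> (g' n) (T', K1(key ?\<Delta> \<mapsto> g' n))"
      using run get condition_dec_cnf[OF x, of a] by (metis branch)
    moreover have "avoids key (K1(key ?\<Delta> \<mapsto> g' n)) E" if "E \<inter> vars ?\<Delta> = {}" "avoids key K E" for E
      using that is_cnf 1(5)[of E] by (intro avoids_update) (auto simp: vars_dec_cnf)
    moreover have "S \<union> {n} \<subseteq> insert n S1" using 1(2) by blast
    moreover have "\<forall>m \<in> S. g' m = g m" using 1(2,4) 2(2) by auto
    ultimately show "\<exists>S' g' T' K'. dpll key (T, K) ?\<Delta> (g' n) (T', K') \<and> sim S' g' T' \<and>
        S \<union> {n} \<subseteq> S' \<and> (\<forall>n\<in>S. g' n = g n) \<and>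
        (\<forall>E. E \<inter> vars ?\<Delta> = {} \<longrightarrow> avoids key K E \<longrightarrow> avoids key K' E)"
      using 2(1) by blast
  qed
  then show ?thesis
    using le is_cnf vars by (auto simp: generates_def dec_cnf_def)
qed

lemma ex_generates_list:
  assumes "\<And>n a. n \<in> set ns \<Longrightarrow> B \<le> a \<Longrightarrow> \<exists>b \<Delta>. generates n a b \<Delta>"
    and "sorted_wrt (\<lambda>m m'. dvars C m \<inter> dvars C m' = {}) ns" and "B \<le> a"
  shows "\<exists>b \<Delta>s. generates_list ns a b \<Delta>s"
  using assms
proof (induction ns arbitrary: a)
  case Nil
  have "realizes (\<lambda>s g s'. dpll_list key s [] (map g []) s') {} {} {a..<a}"
    unfolding realizes_def
  proof (intro allI impI)
    fix S g T K assume "sim S g T"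
    moreover have "dpll_list key (T, K) [] (map g []) (T, K)"
      by (simp add: list_nil)
    ultimately show "\<exists>S' g' T' K'. dpll_list key (T, K) [] (map g' []) (T', K') \<and> sim S' g' T' \<and>
        S \<union> {} \<subseteq> S' \<and> (\<forall>n\<in>S. g' n = g n) \<and>
        (\<forall>E. E \<inter> {} = {} \<longrightarrow> avoids key K E \<longrightarrow> avoids key K' E)"
      by (intro exI[of _ S] exI[of _ g] exI[of _ T] exI[of _ K]) simp
  qed
  then have "generates_list [] a a []" by (simp add: generates_list_def)
  then show ?case by blast
next
  case (Cons n ns)
  obtain b \<Delta> where gen: "generates n a b \<Delta>" using Cons.prems by (meson list.set_intros(1))
  then have ab: "a \<le> b" and vars: "vars \<Delta> \<subseteq> dvars C n \<union> {a..<b}" by (auto simp: generates_def)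
  have "\<exists>d \<Delta>s. generates_list ns b d \<Delta>s"
    by (rule Cons.IH) (use Cons.prems ab in auto)
  then obtain d \<Delta>s where gens: "generates_list ns b d \<Delta>s" by blast
  let ?V = "\<Union>\<Delta> \<in> set \<Delta>s. vars \<Delta>"
  have bd: "b \<le> d" and varss: "?V \<subseteq> (\<Union>n \<in> set ns. dvars C n) \<union> {b..<d}"
    using gens by (auto simp: generates_list_def)
  have fresh: "dvars C m \<inter> {a..<d} = {}" for m by (rule dvars_fresh[OF Cons.prems(3)])
  \<comment> \<open>Overlap with the later formulas is excluded in two ways: their fresh variables
    come from a later interval, and their decision variables belong to nodes with
    \<open>dvars\<close> disjoint from those of \<open>n\<close>.\<close>
  have 1: "vars \<Delta> \<inter> {b..<d} = {}"
    using vars dvars_fresh[of b n d] Cons.prems(3) ab by fastforce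
  moreover have "vars \<Delta> \<inter> dvars C m = {}" if "m \<in> set ns" for m
    using vars that Cons.prems(2) dvars_fresh[OF Cons.prems(3), of m b] by fastforce
  ultimately have disj: "vars \<Delta> \<inter> ?V = {}" using varss by blast
  have r1: "realizes (\<lambda>s g s'. dpll key s \<Delta> (g n) s') {n} (vars \<Delta>) {a..<b}"
    and r2: "realizes (\<lambda>s g s'. dpll_list key s \<Delta>s (map g ns) s') (set ns) ?V {b..<d}"
    using gen gens by (auto simp: generates_def generates_list_def)
  have "realizes (\<lambda>s g s2. \<exists>s1. dpll key s \<Delta> (g n) s1 \<and> dpll_list key s1 \<Delta>s (map g ns) s2)
      ({n} \<union> set ns) (vars \<Delta> \<union> ?V) {a..<d}"
    by (rule realizes_seq[OF r1 r2 1]) (use ab bd in auto)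
  then have "realizes (\<lambda>s g s'. dpll_list key s (\<Delta> # \<Delta>s) (map g (n # ns)) s')
      (set (n # ns)) (\<Union>\<Delta> \<in> set (\<Delta> # \<Delta>s). vars \<Delta>) {a..<d}"
    by simp (elim realizes_mono, auto intro: list_cons)
  moreover have "(\<Union>\<Delta> \<in> set (\<Delta> # \<Delta>s). vars \<Delta>) \<subseteq> (\<Union>n \<in> set (n # ns). dvars C n) \<union> {a..<d}"
    using vars varss ab bd by fastforce
  ultimately have "generates_list (n # ns) a d (\<Delta> # \<Delta>s)"
    using gen gens disj ab bd unfolding generates_def generates_list_def by auto
  then show ?case by blast
qed

text \<open>Each formula mentions some variable, so disjoint variable sets force distinct formulas;
  a shared clause, being nonempty, would yield a shared variable.\<close>

lemma components_generates_list:
  assumes gens: "generates_list ns a b \<Delta>s"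
  shows "components (\<Union>(set \<Delta>s)) \<Delta>s"
proof -
  have ne: "vars \<Delta> \<noteq> {}" "{} \<notin> \<Delta>" "\<Delta> \<noteq> {}" if "\<Delta> \<in> set \<Delta>s" for \<Delta>
    using gens that vars_nonempty by (auto simp: generates_list_def)
  have disj: "vars (\<Delta>s ! i) \<inter> vars (\<Delta>s ! j) = {}" if "i < j" "j < length \<Delta>s" for i j
    using gens that by (auto simp: generates_list_def sorted_wrt_iff_nth_less)
  have disj': "vars (\<Delta>s ! i) \<inter> vars (\<Delta>s ! j) = {}" if "i \<noteq> j" "i < length \<Delta>s" "j < length \<Delta>s" for i j
    using disj[of i j] disj[of j i] that by (cases "i < j") auto
  have dist: "distinct \<Delta>s"
    unfolding distinct_conv_nth using disj' ne(1) by (metis Int_absorb nth_mem)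
  have fam: "disjoint_family_on vars (set \<Delta>s)"
    unfolding disjoint_family_on_def using disj' by (metis in_set_conv_nth)
  moreover have "disjoint (set \<Delta>s)"
    unfolding disjoint_def
  proof (intro ballI impI)
    fix \<Delta> \<Delta>' assume *: "\<Delta> \<in> set \<Delta>s" "\<Delta>' \<in> set \<Delta>s" "\<Delta> \<noteq> \<Delta>'"
    then have v: "vars \<Delta> \<inter> vars \<Delta>' = {}" using fam by (auto simp: disjoint_family_on_def)
    show "\<Delta> \<inter> \<Delta>' = {}"
    proof (rule ccontr)
      assume "\<Delta> \<inter> \<Delta>' \<noteq> {}"
      then obtain d where d: "d \<in> \<Delta>" "d \<in> \<Delta>'" by blast
      then obtain k where "k \<in> d" using ne(2)[OF *(1)] by (cases "d = {}") auto
      then show False using d v by (auto simp: vars_def)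
    qed
  qed
  ultimately show ?thesis
    using dist ne(3) by (auto simp: components_def partition_on_def)
qed

text \<open>An and-node owns no fresh variable: decomposition comes before the cache lookup and
  stores no entry of its own.\<close>

lemma generates_and:
  assumes n: "C n = Some (And M)" and ns: "distinct ns" "set ns = set_mset M"
    and gens: "generates_list ns a b \<Delta>s"
  shows "generates n a b (\<Union>(set \<Delta>s))"
proof -
  let ?\<Delta> = "\<Union>(set \<Delta>s)"
  have ab: "a \<le> b" and len: "length \<Delta>s = length ns"
    and each: "\<And>\<Delta>. \<Delta> \<in> set \<Delta>s \<Longrightarrow> is_cnf \<Delta> \<and> {} \<notin> \<Delta> \<and> \<Delta> \<noteq> {}"
    and varss: "(\<Union>\<Delta> \<in> set \<Delta>s. vars \<Delta>) \<subseteq> (\<Union>n \<in> set ns. dvars C n) \<union> {a..<b}"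
    and real: "realizes (\<lambda>s g s'. dpll_list key s \<Delta>s (map g ns) s') (set ns)
      (\<Union>\<Delta> \<in> set \<Delta>s. vars \<Delta>) {a..<b}"
    using gens by (auto simp: generates_list_def)
  have vars: "vars ?\<Delta> = (\<Union>\<Delta> \<in> set \<Delta>s. vars \<Delta>)" by (auto simp: vars_def)
  have M: "M = mset_set (set ns)"
  proof (rule multiset_eqI)
    fix m
    have "count M m \<le> 1" using red n by (simp add: reduced_def)
    moreover have "1 \<le> count M m" if "m \<in># M" using that by (simp add: Suc_le_eq)
    ultimately show "count M m = count (mset_set (set ns)) m"
      unfolding ns(2) count_mset_set' by (cases "m \<in># M") (auto simp: not_in_iff intro: le_antisym)
  qed
  have "size M \<ge> 2" using cond n by (auto simp: decision_conditions_def)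
  then have two: "card (set ns) \<ge> 2" by (subst (asm) M) simp
  then have len2: "length \<Delta>s > 1" using len ns(1) by (simp add: distinct_card)
  have is_cnf: "is_cnf ?\<Delta>" using each by (auto simp: is_cnf_def)
  have ne: "{} \<notin> ?\<Delta>" "?\<Delta> \<noteq> {}"
    using each len2 by (auto simp: neq_Nil_conv dest: gr_implies_not0) (cases \<Delta>s; force)
  have "realizes (\<lambda>s g s'. dpll key s ?\<Delta> (g n) s') {n} (vars ?\<Delta>) {a..<b}"
    unfolding realizes_def
  proof (intro allI impI)
    fix S g T K assume sim: "sim S g T" and av: "avoids key K {a..<b}"
    from realizesD[OF real this]
    obtain S1 g1 T1 K1 where run: "dpll_list key (T, K) \<Delta>s (map g1 ns) (T1, K1)"
      and 1: "sim S1 g1 T1" "S \<subseteq> S1" "set ns \<subseteq> S1" "\<And>n. n \<in> S \<Longrightarrow> g1 n = g n"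
        "\<And>E. E \<inter> (\<Union>\<Delta> \<in> set \<Delta>s. vars \<Delta>) = {} \<Longrightarrow> avoids key K E \<Longrightarrow> avoids key K1 E"
      by metis
    obtain g' T' where look: "lookup_or_create (map_node g1 (And M)) T1 (g' n) T'"
      and 2: "sim (insert n S1) g' T'" "\<forall>m \<in> S1. g' m = g1 m"
      using sim_node[OF 1(1) n] 1(3) ns by auto
    \<comment> \<open>By injectivity the children keep at least two distinct names, so
      \<open>get_and_node\<close> does not return a lone conjunct, and the renamed label is the one
      it looks up.\<close>
    have inj: "inj_on g1 (set ns)" using 1(1,3) by (auto simp: sim_def intro: inj_on_subset)
    have "card (g1 ` set ns) \<ge> 2" using two card_image[OF inj] by simp
    then have "\<not> is_singleton (set (map g1 ns))" by (auto simp: is_singleton_altdef)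
    moreover have "map_node g1 (And M) = And (mset_set (set (map g1 ns)))"
      by (subst M) (simp add: image_mset_mset_set[OF inj])
    ultimately have get: "get_and_node (set (map g1 ns)) T1 (g' n) T'"
      using look by (simp add: get_and_node_def)
    have "dpll key (T, K) ?\<Delta> (g' n) (T', K1)"
      by (rule decompose[OF ne(1) vars_nonempty[OF ne] components_generates_list[OF gens] len2 run get])
    moreover have "S \<union> {n} \<subseteq> insert n S1" using 1(2) by blast
    moreover have "\<forall>m \<in> S. g' m = g m" using 1(2,4) 2(2) by auto
    ultimately show "\<exists>S' g' T' K'. dpll key (T, K) ?\<Delta> (g' n) (T', K') \<and> sim S' g' T' \<and>
        S \<union> {n} \<subseteq> S' \<and> (\<forall>n\<in>S. g' n = g n) \<and>
        (\<forall>E. E \<inter> vars ?\<Delta> = {} \<longrightarrow> avoids key K E \<longrightarrow> avoids key K' E)"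
      using 2(1) 1(5) unfolding vars by blast
  qed
  moreover have "vars ?\<Delta> \<subseteq> dvars C n \<union> {a..<b}"
    using varss ns dvars_unfold[of C n, OF n] unfolding vars by simp
  ultimately show ?thesis
    using ab is_cnf ne by (auto simp: generates_def)
qed

lemma pair_subset_mset: "m \<in># M \<Longrightarrow> m' \<in># M \<Longrightarrow> m \<noteq> m' \<Longrightarrow> {#m, m'#} \<subseteq># M"
  by (auto simp: subseteq_mset_def Suc_le_eq)

text \<open>Induction on the rank. A shared node is treated anew for each of its occurrences, with a
  different interval each time; therefore \<open>a\<close> is generalized.\<close>

lemma ex_generates:
  assumes "n \<in> dom C" "B \<le> a"
  shows "\<exists>b \<Delta>. generates n a b \<Delta>"
  using assms
proof (induction "card (reach children C n)" arbitrary: n a rule: less_induct)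
  case less
  from less.prems obtain l where n: "C n = Some l" by blast
  have IH: "\<exists>b \<Delta>. generates m a' b \<Delta>" if "m \<in> children l" "B \<le> a'" for m a'
  proof (rule less.hyps)
    show "card (reach children C m) < card (reach children C n)"
      by (rule card_reach_less[OF dag(1-3) n that(1)])
    show "m \<in> dom C" using dag(2) n that(1) by (auto simp: ran_def)
  qed (rule that)
  show ?case
  proof (cases l)
    case (Sink v)
    then show ?thesis using generates_sink n by blast
  next
    case (Dec x low high)
    obtain b \<Delta>0 where low: "generates low (Suc a) b \<Delta>0"
      using IH[of low "Suc a"] Dec less.prems by auto
    then have "B \<le> b" using less.prems by (auto simp: generates_def)
    then obtain d \<Delta>1 where "generates high b d \<Delta>1"
      using IH[of high b] Dec by auto
    then show ?thesis using generates_dec low n Dec less.prems by blast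
  next
    case (And M)
    obtain ns where ns: "set ns = set_mset M" "distinct ns"
      using finite_distinct_list[of "set_mset M"] by auto
    have "sorted_wrt (\<lambda>m m'. dvars C m \<inter> dvars C m' = {}) ns"
      unfolding sorted_wrt_iff_nth_less
    proof (intro allI impI)
      fix i j assume "i < j" "j < length ns"
      then have "{#ns ! i, ns ! j#} \<subseteq># M"
        using ns by (intro pair_subset_mset) (auto simp: nth_eq_iff_index_eq simp flip: ns(1))
      then show "dvars C (ns ! i) \<inter> dvars C (ns ! j) = {}"
        using cond n And by (auto simp: decision_conditions_def)
    qed
    then obtain b \<Delta>s where "generates_list ns a b \<Delta>s"
      using ex_generates_list[of ns a] IH And ns less.prems by auto
    then show ?thesis using generates_and n And ns by blast
  qed
qed

section \<open>From the copied table to an isomorphic returned DAG\<close>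

lemma sim_init:
  "\<exists>S g. sim S g [zero_sink \<mapsto> Sink False, one_sink \<mapsto> Sink True]"
proof -
  \<comment> \<open>The initial table has both sinks, while \<open>C\<close> may lack one;
    \<open>S\<close> collects those that occur. Off \<open>S\<close> the value of \<open>g\<close>
    is an arbitrary default.\<close>
  define S where "S = {n. \<exists>b. C n = Some (Sink b)}"
  define g where "g n = (if C n = Some (Sink True) then one_sink else zero_sink)" for n
  have "inj_on g S"
  proof (rule inj_onI)
    fix m n assume *: "m \<in> S" "n \<in> S" "g m = g n"
    then have "C m = C n" by (auto simp: S_def g_def zero_sink_def one_sink_def split: if_splits)
    then show "m = n" using red * by (auto simp: reduced_def S_def dest: inj_onD)
  qed
  then have "sim S g [zero_sink \<mapsto> Sink False, one_sink \<mapsto> Sink True]"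
    unfolding sim_def by (auto simp: S_def g_def zero_sink_def one_sink_def)
  then show ?thesis by blast
qed

text \<open>All of \<open>C\<close> is reachable from \<open>c\<close> and \<open>S\<close> is
  closed under children, so \<open>S\<close> is the whole circuit and the inverse of
  \<open>g\<close> is the isomorphism. Restriction to the reachable part removes a sink that does
  not occur in \<open>C\<close>.\<close>

lemma sim_returned:
  assumes sim: "sim S g T" and c: "c \<in> S"
  shows "dag_iso (T |` reach children T (g c)) (g c) C c"
proof -
  have SC: "S \<subseteq> dom C" and inj: "inj_on g S"
    and T: "\<And>m. m \<in> S \<Longrightarrow> T (g m) = map_option (map_node g) (C m)"
    and closed: "\<And>m k. m \<in> S \<Longrightarrow> C m = Some k \<Longrightarrow> children k \<subseteq> S"
    using sim by (auto simp: sim_def)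
  have S: "S = dom C"
    using SC dag(5) reach_subset[of c S C children] c closed by blast
  have T': "\<exists>l. C n = Some l \<and> T (g n) = Some (map_node g l)" if "n \<in> S" for n
    using T[OF that] that SC by auto
  let ?R = "reach children T (g c)"
  have "?R \<subseteq> g ` S"
  proof (rule reach_subset)
    fix r l assume r: "r \<in> g ` S" "T r = Some l"
    then obtain m where m: "m \<in> S" "r = g m" by blast
    obtain k where "C m = Some k" "l = map_node g k" using T'[OF m(1)] r m by auto
    then show "children l \<subseteq> g ` S"
      using closed[OF m(1)] by (auto simp: node.set_map)
  qed (use c in simp)
  moreover have "reach children C c \<subseteq> {n \<in> S. g n \<in> ?R}"
  proof (rule reach_subset)
    fix m l assume m: "m \<in> {n \<in> S. g n \<in> ?R}" "C m = Some l"
    then have "T (g m) = Some (map_node g l)" using T'[of m] by auto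
    then have "g ` children l \<subseteq> ?R"
      using m by (auto intro: reach_snoc simp: node.set_map)
    then show "children l \<subseteq> {n \<in> S. g n \<in> ?R}" using closed m by auto
  qed (use c in simp)
  ultimately have R: "?R = g ` S" using dag(5) S by auto
  have dom: "dom (T |` ?R) = g ` S"
  proof -
    have "g ` S \<subseteq> dom T" using T' by blast
    then show ?thesis by (simp add: R Int_absorb1)
  qed
  define f where "f = the_inv_into S g"
  have fg: "f (g n) = n" if "n \<in> S" for n
    unfolding f_def using inj that by (rule the_inv_into_f_f)
  have "bij_betw f (g ` S) S"
    unfolding f_def using inj by (intro bij_betw_the_inv_into) (simp add: bij_betw_def)
  moreover have "C (f r) = map_option (map_node f) ((T |` ?R) r)" if r: "r \<in> g ` S" for r
  proof -
    obtain n where n: "n \<in> S" "r = g n" using r by blast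
    obtain l where l: "C n = Some l" "T (g n) = Some (map_node g l)" using T'[OF n(1)] by blast
    have "map_node f (map_node g l) = map_node id l"
      unfolding node.map_comp by (rule node.map_cong) (use fg closed[OF n(1) l(1)] in auto)
    then show ?thesis using l n fg r by (simp add: R node.map_id)
  qed
  ultimately show ?thesis
    unfolding dag_iso_def dom using fg[OF c] S by auto
qed

lemma ex_dpll_returns: "\<exists>\<Delta> G r. is_cnf \<Delta> \<and> dpll_returns key \<Delta> G r \<and> dag_iso G r C c"
proof -
  obtain b \<Delta> where gen: "generates c B b \<Delta>" using ex_generates[OF dag(4)] by blast
  then have real: "realizes (\<lambda>s g s'. dpll key s \<Delta> (g c) s') {c} (vars \<Delta>) {B..<b}"
    by (simp add: generates_def)
  obtain S g where sim: "sim S g [zero_sink \<mapsto> Sink False, one_sink \<mapsto> Sink True]"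
    using sim_init by blast
  have "avoids key Map.empty {B..<b}" by (simp add: avoids_def)
  from realizesD[OF real sim this] obtain S' g' T' K' where
    "dpll key init_state \<Delta> (g' c) (T', K')" "sim S' g' T'" "c \<in> S'"
    unfolding init_state_def by (metis insert_subset)
  then show ?thesis
    using gen sim_returned unfolding dpll_returns_def generates_def by blast
qed

end

lemma dvars_bounded:
  assumes "finite (dom G)"
  shows "\<exists>B. \<forall>n. dvars G n \<subseteq> {..<B}"
proof -
  have "dvars G n \<subseteq> (\<Union>l \<in> ran G. label_vars l)" for n
    by (force simp: dvars_def ran_def)
  moreover obtain B where "(\<Union>l \<in> ran G. label_vars l) \<subseteq> {..<B}"
    using finite_label_vars[OF assms] by (metis finite_nat_set_iff_bounded lessThan_iff subsetI)
  ultimately show ?thesis by (meson subset_trans)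
qed

theorem theorem3:
  fixes key :: "cnf \<Rightarrow> 'k"
  assumes "sound_key key"
  shows "(\<forall>\<Delta> G r. is_cnf \<Delta> \<longrightarrow> dpll_returns key \<Delta> G r \<longrightarrow>
            reduced G \<and> decision_DNNF_drawing G r) \<and>
         (\<forall>(C :: 'n dag) c. reduced C \<and> decision_DNNF_drawing C c \<longrightarrow>
            (\<exists>\<Delta> G r. is_cnf \<Delta> \<and> dpll_returns key \<Delta> G r \<and> dag_iso G r C c))"
proof (intro conjI allI impI)
  fix \<Delta> G r assume "is_cnf \<Delta>" "dpll_returns key \<Delta> G r"
  then show "reduced G" "decision_DNNF_drawing G r"
    using dpll_returns_reduced_drawing[OF assms] by blast+
next
  fix C :: "'n dag" and c assume C: "reduced C \<and> decision_DNNF_drawing C c"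
  then have "finite (dom C)" by (simp add: decision_DNNF_drawing_def rooted_dag_def)
  then obtain B where "\<And>n. dvars C n \<subseteq> {..<B}" using dvars_bounded by blast
  then interpret reduced_circuit key C c B
    using assms C by unfold_locales auto
  show "\<exists>\<Delta> G r. is_cnf \<Delta> \<and> dpll_returns key \<Delta> G r \<and> dag_iso G r C c"
    by (rule ex_dpll_returns)
qed

end
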